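(* Let $(X,T)$ be a topological dynamical system with a metric $d$ and let $f\in C(X,\mathbb{R})$. Then for any finite or infinite sequence $\mathcal{S}$ of $\mathbb{N}$ and every $\epsilon>0$, \begin{align*} \overline{\mathrm{mdim}}_M(T,f,X,d)&=\limsup_{\delta\to 0}\frac{1}{\log\frac1\delta}\sup_{x\in X}M_{\delta}(T,f,W_{\epsilon,\mathcal{S}}^s(x,T),d)\\ &=\limsup_{\delta\to 0}\frac{1}{\log\frac1\delta}\sup_{x\in X}\mathcal{P}_{\delta}(T,f,W_{\epsilon,\mathcal{S}}^s(x,T),d)\\ &=\limsup_{\delta\to 0}\frac{1}{\log\frac1\delta}\sup_{x\in X}P(T,f,W_{\epsilon,\mathcal{S}}^s(x,T),d,\delta). \end{align*}
   Context: A topological dynamical system (TDS) $(X,T)$ with metric $d$: $X$ is a compact metrizable space with compatible metric $d$, and $T:X\to X$ is continuous. $C(X,\mathbb{R})$ is the space of real continuous functions with the sup norm. $\mathbb{N}=\{0,1,2,\dots\}$ for the time sequences below. Write $S_nf(x)=\sum_{j=0}^{n-1}f(T^jx)$, $d_n(x,y)=\max_{0\le j\le n-1}d(T^jx,T^jy)$, $B_n(x,\epsilon)=\{y:d_n(x,y)<\epsilon\}$, $\overline B_n(x,\epsilon)=\{y:d_n(x,y)\le\epsilon\}$. For a sequence (set of times) $\mathcal S\subset\mathbb{N}$, $W^s_{\epsilon,\mathcal S}(x,T)=\{y\in X: d(T^jx,T^jy)\le\epsilon \text{ for all } j\in\mathcal S\}$. For non-empty $Z\subset X$, a set $E\subset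 X$ is an $(n,\epsilon)$-spanning set of $Z$ if every $x\in Z$ has some $y\in E$ with $d_n(x,y)<\epsilon$. Put $P_n(T,f,Z,d,\epsilon)=\inf\{\sum_{x\in E}(1/\epsilon)^{S_nf(x)}\}$ over all $(n,\epsilon)$-spanning sets $E$ of $Z$, $P(T,f,Z,d,\epsilon)=\limsup_{n\to\infty}\frac1n\log P_n(T,f,Z,d,\epsilon)$, and $\overline{\mathrm{mdim}}_M(T,f,Z,d)=\limsup_{\epsilon\to0}\frac{P(T,f,Z,d,\epsilon)}{\log\frac1\epsilon}$. For $s\in\mathbb{R}$, $N\in\mathbb{N}$, $\epsilon>0$, let $M^s_{N,\epsilon}(T,f,Z,d)=\inf\{\sum_{i\in I}e^{-n_is+\log\frac1\epsilon\cdot S_{n_i}f(x_i)}\}$ over all finite or countable covers $\{B_{n_i}(x_i,\epsilon)\}_{i\in I}$ of $Z$ with $n_i\ge N$, $x_i\in X$; $M^s_\epsilon(T,f,Z,d)=\lim_{N\to\infty}M^s_{N,\epsilon}(T,f,Z,d)$; $M_\epsilon(T,f,Z,d)=\inf\{s:M^s_\epsilon(T,f,Z,d)=0\}=\sup\{s:M^s_\epsilon(T,f,Z,d)=\infty\}$. Let $P^s_{N,\epsilon}(T,f,Z,d)=\sup\{\sum_{i\in I}e^{-n_is+\log\frac1\epsilon\cdot S_{n_i}f(x_i)}\}$ over all finite or countable pairwise disjoint families $\{\overline B_{n_i}(x_i,\epsilon)\}_{i\in I}$ with $n_i\ge N$, $x_i\in Z$; $P^s_\epsilon(T,f,Z,d)=\lim_{N\to\infty}P^s_{N,\epsilon}(T,f,Z,d)$;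 $\mathcal P^s_\epsilon(T,f,Z,d)=\inf\{\sum_{i\ge1}P^s_\epsilon(T,f,Z_i,d):\bigcup_{i\ge1}Z_i\supseteq Z\}$; $\mathcal P_\epsilon(T,f,Z,d)=\inf\{s:\mathcal P^s_\epsilon(T,f,Z,d)=0\}=\sup\{s:\mathcal P^s_\epsilon(T,f,Z,d)=\infty\}$. *)

theory Defs
  imports "HOL-Analysis.Analysis"
begin

text \<open>
  The phase space is a whole type of class \<^class>\<open>metric_space\<close>, with \<^const>\<open>dist\<close> as the
  compatible metric; its compactness is an assumption of the theorem.  Potentially infinite
  sums of positive weights are taken in \<^typ>\<open>ennreal\<close>, and the quantities derived from them by
  logarithms or critical exponents in \<^typ>\<open>ereal\<close>.
\<close>

definition birkhoff_sum :: "('a \<Rightarrow> 'a) \<Rightarrow> ('a \<Rightarrow> real) \<Rightarrow> nat \<Rightarrow> 'a \<Rightarrow> real" where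
  "birkhoff_sum T f n x = (\<Sum>j<n. f ((T ^^ j) x))"

text \<open>The maximum over the empty index set (\<open>n = 0\<close>) is read as \<open>0\<close>.\<close>

definition bowen_dist :: "('a::metric_space \<Rightarrow> 'a) \<Rightarrow> nat \<Rightarrow> 'a \<Rightarrow> 'a \<Rightarrow> real" where
  "bowen_dist T n x y =
     (if n = 0 then 0 else (MAX j\<in>{..<n}. dist ((T ^^ j) x) ((T ^^ j) y)))"

definition bowen_ball :: "('a::metric_space \<Rightarrow> 'a) \<Rightarrow> nat \<Rightarrow> 'a \<Rightarrow> real \<Rightarrow> 'a set" where
  "bowen_ball T n x \<epsilon> = {y. bowen_dist T n x y < \<epsilon>}"

definition bowen_cball :: "('a::metric_space \<Rightarrow> 'a) \<Rightarrow> nat \<Rightarrow> 'a \<Rightarrow> real \<Rightarrow> 'a set" where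
  "bowen_cball T n x \<epsilon> = {y. bowen_dist T n x y \<le> \<epsilon>}"

definition stable_set :: "('a::metric_space \<Rightarrow> 'a) \<Rightarrow> real \<Rightarrow> nat set \<Rightarrow> 'a \<Rightarrow> 'a set" where
  "stable_set T \<epsilon> S x = {y. \<forall>j\<in>S. dist ((T ^^ j) x) ((T ^^ j) y) \<le> \<epsilon>}"

definition ext_ln :: "ennreal \<Rightarrow> ereal" where
  "ext_ln a = (if a = 0 then -\<infinity> else if a = top then \<infinity> else ereal (ln (enn2real a)))"


subsection \<open>Spanning sets and upper metric mean dimension with potential\<close>

definition spanning_set ::
    "('a::metric_space \<Rightarrow> 'a) \<Rightarrow> nat \<Rightarrow> real \<Rightarrow> 'a set \<Rightarrow> 'a set \<Rightarrow> bool" where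
  "spanning_set T n \<epsilon> Z E \<longleftrightarrow> (\<forall>x\<in>Z. \<exists>y\<in>E. bowen_dist T n x y < \<epsilon>)"

definition span_sum ::
    "('a::metric_space \<Rightarrow> 'a) \<Rightarrow> ('a \<Rightarrow> real) \<Rightarrow> 'a set \<Rightarrow> real \<Rightarrow> nat \<Rightarrow> ennreal" where
  "span_sum T f Z \<epsilon> n =
     (INF E \<in> {E. spanning_set T n \<epsilon> Z E}.
        \<Sum>\<^sub>\<infinity>x\<in>E. ennreal ((1 / \<epsilon>) powr birkhoff_sum T f n x))"

definition span_pressure ::
    "('a::metric_space \<Rightarrow> 'a) \<Rightarrow> ('a \<Rightarrow> real) \<Rightarrow> 'a set \<Rightarrow> real \<Rightarrow> ereal" where
  "span_pressure T f Z \<epsilon> = limsup (\<lambda>n. ereal (1 / real n) * ext_ln (span_sum T f Z \<epsilon> n))"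

definition upper_mdim ::
    "('a::metric_space \<Rightarrow> 'a) \<Rightarrow> ('a \<Rightarrow> real) \<Rightarrow> 'a set \<Rightarrow> ereal" where
  "upper_mdim T f Z = Limsup (at_right 0) (\<lambda>\<epsilon>. span_pressure T f Z \<epsilon> / ereal (ln (1 / \<epsilon>)))"


subsection \<open>Bowen and packing pressures\<close>

text \<open>
  A finite or countable family of Bowen balls is given by an index set \<open>I \<subseteq> \<nat>\<close>, the
  lengths \<open>n i\<close> and the centres \<open>x i\<close>; only the values on \<open>I\<close> matter.
\<close>

definition family_sum ::
    "('a \<Rightarrow> 'a) \<Rightarrow> ('a \<Rightarrow> real) \<Rightarrow> real \<Rightarrow> real \<Rightarrow> nat set \<Rightarrow> (nat \<Rightarrow> nat) \<Rightarrow> (nat \<Rightarrow> 'a) \<Rightarrow> ennreal" where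
  "family_sum T f s \<epsilon> I n x =
     (\<Sum>\<^sub>\<infinity>i\<in>I. ennreal (exp (- real (n i) * s + ln (1 / \<epsilon>) * birkhoff_sum T f (n i) (x i))))"

definition bowen_pre ::
    "('a::metric_space \<Rightarrow> 'a) \<Rightarrow> ('a \<Rightarrow> real) \<Rightarrow> 'a set \<Rightarrow> real \<Rightarrow> real \<Rightarrow> nat \<Rightarrow> ennreal" where
  "bowen_pre T f Z s \<epsilon> N =
     Inf {family_sum T f s \<epsilon> I n x | I n x.
            (\<forall>i\<in>I. N \<le> n i) \<and> Z \<subseteq> (\<Union>i\<in>I. bowen_ball T (n i) (x i) \<epsilon>)}"

definition bowen_measure ::
    "('a::metric_space \<Rightarrow> 'a) \<Rightarrow> ('a \<Rightarrow> real) \<Rightarrow> 'a set \<Rightarrow> real \<Rightarrow> real \<Rightarrow> ennreal" where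
  "bowen_measure T f Z s \<epsilon> = lim (\<lambda>N. bowen_pre T f Z s \<epsilon> N)"

definition bowen_pressure ::
    "('a::metric_space \<Rightarrow> 'a) \<Rightarrow> ('a \<Rightarrow> real) \<Rightarrow> 'a set \<Rightarrow> real \<Rightarrow> ereal" where
  "bowen_pressure T f Z \<epsilon> = Inf {ereal s | s. bowen_measure T f Z s \<epsilon> = 0}"

definition packing_pre ::
    "('a::metric_space \<Rightarrow> 'a) \<Rightarrow> ('a \<Rightarrow> real) \<Rightarrow> 'a set \<Rightarrow> real \<Rightarrow> real \<Rightarrow> nat \<Rightarrow> ennreal" where
  "packing_pre T f Z s \<epsilon> N =
     Sup {family_sum T f s \<epsilon> I n x | I n x.
            (\<forall>i\<in>I. N \<le> n i \<and> x i \<in> Z) \<and>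
            disjoint_family_on (\<lambda>i. bowen_cball T (n i) (x i) \<epsilon>) I}"

definition packing_premeasure ::
    "('a::metric_space \<Rightarrow> 'a) \<Rightarrow> ('a \<Rightarrow> real) \<Rightarrow> 'a set \<Rightarrow> real \<Rightarrow> real \<Rightarrow> ennreal" where
  "packing_premeasure T f Z s \<epsilon> = lim (\<lambda>N. packing_pre T f Z s \<epsilon> N)"

definition packing_measure ::
    "('a::metric_space \<Rightarrow> 'a) \<Rightarrow> ('a \<Rightarrow> real) \<Rightarrow> 'a set \<Rightarrow> real \<Rightarrow> real \<Rightarrow> ennreal" where
  "packing_measure T f Z s \<epsilon> =
     (INF A \<in> {A :: nat \<Rightarrow> 'a set. Z \<subseteq> (\<Union>i. A i)}. \<Sum>i. packing_premeasure T f (A i) s \<epsilon>)"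

definition packing_pressure ::
    "('a::metric_space \<Rightarrow> 'a) \<Rightarrow> ('a \<Rightarrow> real) \<Rightarrow> 'a set \<Rightarrow> real \<Rightarrow> ereal" where
  "packing_pressure T f Z \<epsilon> = Inf {ereal s | s. packing_measure T f Z s \<epsilon> = 0}"

end

theory Submission
  imports Defs "HOL-Real_Asymp.Real_Asymp"
begin

text \<open>
  For every subset the Bowen pressure is at most the packing pressure, which is at most the
  spanning pressure, up to rescaling \<open>\<delta>\<close> and errors \<open>o(ln (1 / \<delta>))\<close> that the limit does not see.
  The converse is that the Bowen pressures of the stable sets bound the spanning pressure
  of the whole space.  A finite Bowen cover of weight at most \<open>1\<close> of a compact stable set still
  covers a closed Bowen ball \<open>bowen_cball T m y \<epsilon>\<close> for all \<open>y\<close> near its centre, so \<open>m\<close> can be chosen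
  uniformly.  Concatenating such covers along orbits covers \<open>bowen_cball T (n + m) y \<epsilon>\<close> by
  pieces of \<open>d\<^sub>n\<close>-diameter below \<open>2\<delta>\<close>, of total weight at most \<open>1\<close>.  Finally \<open>X\<close> is a union of at
  most \<open>R\<^sup>n\<^sup>+\<^sup>m\<close> such closed balls with \<open>R\<close> depending only on \<open>\<epsilon>\<close>; the resulting error \<open>ln R\<close> disappears
  after division by \<open>ln (1 / \<delta>)\<close>.  Every stable set contains the one for
  \<open>S = UNIV\<close>, so it suffices to bound by the latter.
\<close>

section \<open>Sums in \<^typ>\<open>ennreal\<close> and logarithmic scales\<close>

lemma sum_le_infsum_ennreal:
  fixes g :: "'b \<Rightarrow> ennreal"
  assumes "finite F" "F \<subseteq> A"
  shows "sum g F \<le> infsum g A"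
  using assms by (subst nonneg_infsum_complete) (auto intro!: SUP_upper)

lemma infsum_ennreal_le:
  fixes g :: "'b \<Rightarrow> ennreal"
  assumes "\<And>F. finite F \<Longrightarrow> F \<subseteq> A \<Longrightarrow> sum g F \<le> B"
  shows "infsum g A \<le> B"
  using assms by (subst nonneg_infsum_complete) (auto intro!: SUP_least)

lemma sum_set_le_sum_list:
  fixes h :: "'b \<Rightarrow> real"
  assumes "\<And>x. x \<in> set xs \<Longrightarrow> 0 \<le> h x"
  shows "sum h (set xs) \<le> sum_list (map h xs)"
  using assms
proof (induction xs)
  case (Cons a xs)
  then show ?case
    by (cases "a \<in> set xs") (auto simp: insert_absorb add_increasing)
qed simp

lemma sum_list_concat_map:
  fixes h :: "'c \<Rightarrow> 'd::monoid_add"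
  shows "sum_list (map h (concat (map g xs))) = (\<Sum>p\<leftarrow>xs. sum_list (map h (g p)))"
  by (induction xs) auto

text \<open>A finite subsum meets only finitely many \<open>P i\<close>, and a point lying in
  several of them is counted once on the left but repeatedly on the right.\<close>

lemma infsum_UN_ennreal_le:
  fixes g :: "'b \<Rightarrow> ennreal"
  assumes fin: "\<And>i. finite (P i)" and le: "\<And>i::nat. sum g (P i) \<le> c i"
  shows "infsum g (\<Union>i. P i) \<le> (\<Sum>i. c i)"
proof (rule infsum_ennreal_le)
  fix F assume F: "finite F" "F \<subseteq> (\<Union>i. P i)"
  then obtain J where J: "finite J" "F \<subseteq> (\<Union>i\<in>J. P i)"
    by (metis finite_subset_image finite_subset_Union)
  have "sum g F \<le> sum g (\<Union>i\<in>J. P i)"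
    using J fin by (intro sum_mono2) auto
  also have "\<dots> \<le> (\<Sum>i\<in>J. sum g (P i))"
    using J(1)
  proof induction
    case (insert j J)
    have "sum g (P j \<union> (\<Union>i\<in>J. P i)) \<le> sum g (P j) + sum g (\<Union>i\<in>J. P i)"
      using fin insert(1) by (subst sum.union_inter[symmetric]) auto
    with insert show ?case
      by (auto intro: order_trans add_left_mono)
  qed simp
  also have "\<dots> \<le> (\<Sum>i\<in>J. c i)"
    by (intro sum_mono le)
  also have "\<dots> \<le> (\<Sum>i. c i)"
    using J(1) by (intro sum_le_suminf) auto
  finally show "sum g F \<le> (\<Sum>i. c i)" .
qed

text \<open>Packings by balls of length at least \<open>N\<close> will be sorted by length; this
  geometric tail makes their total weight vanish as \<open>N\<close> grows.\<close>

lemma sum_power_tail_le: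
  fixes r :: real
  assumes "0 \<le> r" "r < 1" "finite A" "\<And>k. k \<in> A \<Longrightarrow> N \<le> k"
  shows "(\<Sum>k\<in>A. r ^ k) \<le> r ^ N / (1 - r)"
proof -
  have "(\<Sum>k\<in>A. r ^ k) = (\<Sum>k\<in>(\<lambda>k. k - N) ` A. r ^ (k + N))"
    using assms(4) by (subst sum.reindex) (auto simp: inj_on_def intro!: sum.cong, metis le_add_diff_inverse2)
  also have "\<dots> \<le> (\<Sum>k. r ^ (k + N))"
    using assms by (intro sum_le_suminf summable_ignore_initial_segment summable_geometric) auto
  also have "\<dots> = r ^ N / (1 - r)"
    using assms by (simp add: power_add suminf_mult2[symmetric] summable_geometric suminf_geometric)
  finally show ?thesis .
qed

section \<open>Extended logarithm and limits on the scale of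
  \<open>ln (1 / \<delta>)\<close>\<close>

lemma ext_ln_le_ereal:
  assumes "a \<le> ennreal (exp t)"
  shows "ext_ln a \<le> ereal t"
proof (cases a)
  case (real r)
  then have "r \<le> exp t" using assms by simp
  then have "r > 0 \<Longrightarrow> ln r \<le> t" by (metis ln_exp ln_mono)
  then show ?thesis using real by (auto simp: ext_ln_def)
next
  case top
  then show ?thesis using assms by (simp add: top_unique)
qed

lemma ext_ln_lessD:
  assumes "ext_ln a < ereal t"
  shows "a \<le> ennreal (exp t)"
proof (cases a)
  case (real r)
  show ?thesis
  proof (cases "r = 0")
    case False
    then have "ln r < t" "r > 0" using real assms by (auto simp: ext_ln_def)
    then have "r < exp t" by (metis exp_less_mono exp_ln)
    then show ?thesis using real by (simp add: ennreal_leI)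
  qed (use real in auto)
next
  case top
  then show ?thesis using assms by (simp add: ext_ln_def)
qed

lemma ext_ln_mono: "a \<le> b \<Longrightarrow> ext_ln a \<le> ext_ln b"
  by (cases a; cases b) (auto simp: ext_ln_def top_unique intro!: ln_mono)

text \<open>
  Comparing all real upper bounds of \<open>b\<close> rather than \<open>b\<close> itself avoids any finiteness
  assumption; rescaling \<open>\<delta>\<close> and adding \<open>o(ln (1 / \<delta>))\<close> are invisible in the limit.
\<close>

lemma Limsup_log_scale_le:
  fixes a b :: "real \<Rightarrow> ereal"
  assumes k: "k > 0"
    and le: "\<And>\<eta>. \<eta> > 0 \<Longrightarrow> \<forall>\<^sub>F \<delta> in at_right 0.
      \<forall>s. b \<delta> < ereal s \<longrightarrow> a (k * \<delta>) \<le> ereal (s + \<eta> * ln (1 / \<delta>) + C)"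
  shows "Limsup (at_right 0) (\<lambda>\<delta>. ereal (1 / ln (1 / \<delta>)) * a \<delta>)
    \<le> Limsup (at_right 0) (\<lambda>\<delta>. ereal (1 / ln (1 / \<delta>)) * b \<delta>)"
  unfolding Limsup_le_iff
proof (intro allI impI)
  fix y :: ereal
  assume "Limsup (at_right 0) (\<lambda>\<delta>. ereal (1 / ln (1 / \<delta>)) * b \<delta>) < y"
  then obtain r where r: "Limsup (at_right 0) (\<lambda>\<delta>. ereal (1 / ln (1 / \<delta>)) * b \<delta>) < ereal r"
      "ereal r < y"
    using ereal_dense2 by blast
  obtain r2 where r2: "ereal r < ereal r2" "ereal r2 < y"
    using ereal_dense2[OF r(2)] by blast
  \<comment> \<open>Half the gap, so that the slope \<open>r + \<eta>\<close> still lies strictly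
    below \<open>r2\<close>.\<close>
  define \<eta> where "\<eta> = (r2 - r) / 2"
  have \<eta>: "\<eta> > 0" "r + \<eta> < r2" using r2 by (auto simp: \<eta>_def field_simps)
  have small: "\<forall>\<^sub>F \<delta> in at_right 0. 0 < \<delta> \<and> \<delta> < 1 \<and> k * \<delta> < (1::real)"
    using k by (auto simp: eventually_at_right_field field_simps intro!: exI[of _ "min 1 (1 / k)"])
  \<comment> \<open>\<open>ln (1 / (k * \<delta>))\<close> and \<open>ln (1 / \<delta>)\<close>
    differ by the constant \<open>ln k\<close>, so their quotient tends to 1 and \<open>C\<close>
    disappears.\<close>
  have "((\<lambda>\<delta>. ((r + \<eta>) * ln (1 / \<delta>) + C) / ln (1 / (k * \<delta>))) \<longlongrightarrow> r + \<eta>) (at_right 0)"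
    using k by real_asymp
  then have lim: "\<forall>\<^sub>F \<delta> in at_right 0. ((r + \<eta>) * ln (1 / \<delta>) + C) / ln (1 / (k * \<delta>)) < r2"
    using \<eta>(2) by (rule order_tendstoD)
  have "\<forall>\<^sub>F \<delta> in at_right 0. ereal (1 / ln (1 / (k * \<delta>))) * a (k * \<delta>) < y"
    using small lim le[OF \<eta>(1)] Limsup_lessD[OF r(1)]
  proof eventually_elim
    case (elim \<delta>)
    have pos: "ln (1 / \<delta>) > 0" "ln (1 / (k * \<delta>)) > 0" using elim k by auto
    have "b \<delta> < ereal (r * ln (1 / \<delta>))"
      using elim(4) pos(1) by (cases "b \<delta>") (auto simp: field_simps)
    then have "a (k * \<delta>) \<le> ereal (r * ln (1 / \<delta>) + \<eta> * ln (1 / \<delta>) + C)"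
      using elim(3) by blast
    then have "ereal (1 / ln (1 / (k * \<delta>))) * a (k * \<delta>)
        \<le> ereal (1 / ln (1 / (k * \<delta>))) * ereal (r * ln (1 / \<delta>) + \<eta> * ln (1 / \<delta>) + C)"
      using pos by (intro ereal_mult_left_mono) auto
    also have "\<dots> < ereal r2"
      using elim(2) by (simp add: algebra_simps add_divide_distrib)
    finally show ?case using r2(2) by (rule less_trans)
  qed
  \<comment> \<open>The bound is known at \<open>k * \<delta>\<close>; substituting
    \<open>\<delta> / k\<close> undoes the rescaling.\<close>
  moreover have "filterlim (\<lambda>\<delta>. (1 / k) * \<delta>) (at_right 0) (at_right (0::real))"
    using k by (intro filterlim_times_pos[where p = 0] filterlim_ident) auto
  ultimately have "\<forall>\<^sub>F \<delta> in at_right 0.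
      ereal (1 / ln (1 / (k * ((1 / k) * \<delta>)))) * a (k * ((1 / k) * \<delta>)) < y"
    by (rule eventually_compose_filterlim)
  then show "\<forall>\<^sub>F \<delta> in at_right 0. ereal (1 / ln (1 / \<delta>)) * a \<delta> < y"
    using k by simp
qed

section \<open>Bowen metrics and Birkhoff sums\<close>

text \<open>Positivity of \<open>e\<close> makes both sides true for \<open>n = 0\<close>, where the
  distance is 0 by convention.\<close>

lemma bowen_dist_less_iff:
  "0 < e \<Longrightarrow> bowen_dist T n x y < e \<longleftrightarrow> (\<forall>j<n. dist ((T ^^ j) x) ((T ^^ j) y) < e)"
  by (cases n) (auto simp: bowen_dist_def lessThan_empty_iff)

lemma bowen_dist_le_iff:
  "0 \<le> e \<Longrightarrow> bowen_dist T n x y \<le> e \<longleftrightarrow> (\<forall>j<n. dist ((T ^^ j) x) ((T ^^ j) y) \<le> e)"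
  by (cases n) (auto simp: bowen_dist_def lessThan_empty_iff)

lemma funpow_add_apply: "(T ^^ (m + n)) x = (T ^^ n) ((T ^^ m) x)"
  by (subst add.commute) (simp add: funpow_add)

lemma continuous_on_funpow_UNIV:
  fixes T :: "'a::topological_space \<Rightarrow> 'a"
  assumes "continuous_on UNIV T"
  shows "continuous_on UNIV (T ^^ j)"
proof (induction j)
  case (Suc j)
  then show ?case
    using continuous_on_compose2[OF assms Suc] by (simp add: o_def)
qed (simp add: id_def)

lemma open_bowen_ball:
  fixes T :: "'a::metric_space \<Rightarrow> 'a"
  assumes "continuous_on UNIV T" "0 < e"
  shows "open (bowen_ball T n x e)"
proof -
  have "bowen_ball T n x e = (\<Inter>j\<in>{..<n}. {y. dist ((T ^^ j) x) ((T ^^ j) y) < e})"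
    using assms(2) by (auto simp: bowen_ball_def bowen_dist_less_iff)
  also have "open \<dots>"
    by (intro open_INT finite_lessThan ballI open_Collect_less continuous_intros
        continuous_on_funpow_UNIV assms(1))
  finally show ?thesis .
qed

lemma closed_stable_set:
  fixes T :: "'a::metric_space \<Rightarrow> 'a"
  assumes "continuous_on UNIV T"
  shows "closed (stable_set T e S x)"
proof -
  have "stable_set T e S x = (\<Inter>j\<in>S. {y. dist ((T ^^ j) x) ((T ^^ j) y) \<le> e})"
    by (auto simp: stable_set_def)
  also have "closed \<dots>"
    by (intro closed_INT ballI closed_Collect_le continuous_intros
        continuous_on_funpow_UNIV assms)
  finally show ?thesis .
qed

lemma birkhoff_sum_add:
  "birkhoff_sum T f (m + n) x = birkhoff_sum T f m x + birkhoff_sum T f n ((T ^^ m) x)"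
  by (induction n) (auto simp: birkhoff_sum_def funpow_add_apply)

lemma abs_birkhoff_sum_le:
  assumes "\<And>x. \<bar>f x\<bar> \<le> K"
  shows "\<bar>birkhoff_sum T f n x\<bar> \<le> real n * K"
  unfolding birkhoff_sum_def
  using sum_norm_le[of "{..<n}" "\<lambda>j. f ((T ^^ j) x)" "\<lambda>_. K"] assms by simp

lemma birkhoff_sum_close:
  assumes "\<And>x y. dist x y \<le> \<delta> \<Longrightarrow> \<bar>f x - f y\<bar> \<le> \<eta>"
    and "\<And>j. j < n \<Longrightarrow> dist ((T ^^ j) x) ((T ^^ j) y) \<le> \<delta>"
  shows "birkhoff_sum T f n x \<le> birkhoff_sum T f n y + real n * \<eta>"
proof -
  have "birkhoff_sum T f n x \<le> (\<Sum>j<n. f ((T ^^ j) y) + \<eta>)"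
    unfolding birkhoff_sum_def
    using assms(1)[OF assms(2)] by (intro sum_mono) (auto simp: abs_le_iff diff_le_eq algebra_simps)
  then show ?thesis by (simp add: birkhoff_sum_def sum.distrib)
qed

lemma compact_finite_bowen_cover:
  fixes T :: "'a::metric_space \<Rightarrow> 'a"
  assumes "compact (UNIV :: 'a set)" "continuous_on UNIV T" "0 < e"
  obtains C where "finite C" "\<And>x. \<exists>c\<in>C. bowen_dist T n c x < e"
proof -
  have "UNIV \<subseteq> (\<Union>c\<in>UNIV. bowen_ball T n c e)"
    using assms(3) by (auto simp: bowen_ball_def bowen_dist_less_iff)
  then obtain C where "finite C" "UNIV \<subseteq> (\<Union>c\<in>C. bowen_ball T n c e)"
    by (rule compactE_image[OF assms(1), where f = "\<lambda>c. bowen_ball T n c e" and C = UNIV, rotated])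
      (auto intro: open_bowen_ball assms(2,3))
  then show ?thesis by (intro that[of C]) (auto simp: bowen_ball_def)
qed

section \<open>Bowen and packing pressures\<close>

text \<open>Keeping length and centre in one pair lets covers be plain sets of pairs, which can be
  united and thinned out without reindexing.\<close>

definition orbit_weight ::
    "('a \<Rightarrow> 'a) \<Rightarrow> ('a \<Rightarrow> real) \<Rightarrow> real \<Rightarrow> real \<Rightarrow> nat \<times> 'a \<Rightarrow> real" where
  "orbit_weight T f s \<delta> p =
     exp (- real (fst p) * s + ln (1 / \<delta>) * birkhoff_sum T f (fst p) (snd p))"

lemma orbit_weight_nonneg [simp]: "0 \<le> orbit_weight T f s \<delta> p"
  by (simp add: orbit_weight_def)

lemma family_sum_orbit_weight:
  "family_sum T f s \<delta> I n x = (\<Sum>\<^sub>\<infinity>i\<in>I. ennreal (orbit_weight T f s \<delta> (n i, x i)))"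
  by (simp add: family_sum_def orbit_weight_def)

text \<open>Raising \<open>N\<close> leaves fewer admissible covers, so the infimum increases and
  its limit is a supremum.\<close>

lemma bowen_measure_eq_SUP: "bowen_measure T f Z s \<delta> = (SUP N. bowen_pre T f Z s \<delta> N)"
  unfolding bowen_measure_def
proof (intro limI LIMSEQ_SUP incseq_SucI)
  fix N
  show "bowen_pre T f Z s \<delta> N \<le> bowen_pre T f Z s \<delta> (Suc N)"
    unfolding bowen_pre_def by (intro Inf_superset_mono) (blast dest: Suc_leD)
qed

lemma packing_pre_antimono:
  assumes "N \<le> M"
  shows "packing_pre T f Z s \<delta> M \<le> packing_pre T f Z s \<delta> N"
  unfolding packing_pre_def using assms by (intro Sup_subset_mono) (blast intro: le_trans)

lemma packing_premeasure_eq_INF: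
  "packing_premeasure T f Z s \<delta> = (INF N. packing_pre T f Z s \<delta> N)"
  unfolding packing_premeasure_def
  by (intro limI LIMSEQ_INF decseq_SucI packing_pre_antimono) simp

lemma packing_premeasure_empty: "packing_premeasure T f {} s \<delta> = 0"
proof -
  have "packing_pre T f {} s \<delta> N = 0" for N
    unfolding packing_pre_def family_sum_def
    by (rule antisym[OF Sup_least]) auto
  then show ?thesis by (simp add: packing_premeasure_eq_INF)
qed

text \<open>Passes from families indexed by naturals to countable sets of pairs, through an
  enumeration of \<open>P\<close>.\<close>

lemma bowen_pre_le_infsum:
  assumes "countable P" "\<And>p. p \<in> P \<Longrightarrow> N \<le> fst p"
    and "Z \<subseteq> (\<Union>p\<in>P. bowen_ball T (fst p) (snd p) \<delta>)"
  shows "bowen_pre T f Z s \<delta> N \<le> (\<Sum>\<^sub>\<infinity>p\<in>P. ennreal (orbit_weight T f s \<delta> p))"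
proof -
  let ?n = "\<lambda>i. fst (from_nat_into P i)" and ?x = "\<lambda>i. snd (from_nat_into P i)"
  have "(\<Sum>\<^sub>\<infinity>p\<in>P. ennreal (orbit_weight T f s \<delta> p)) = family_sum T f s \<delta> (to_nat_on P ` P) ?n ?x"
    unfolding family_sum_orbit_weight using assms(1)
    by (subst infsum_reindex) (auto intro!: infsum_cong)
  moreover have "bowen_pre T f Z s \<delta> N \<le> family_sum T f s \<delta> (to_nat_on P ` P) ?n ?x"
    unfolding bowen_pre_def
  proof (rule Inf_lower, intro CollectI exI conjI)
    show "\<forall>i\<in>to_nat_on P ` P. N \<le> ?n i" using assms(1,2) by auto
    show "Z \<subseteq> (\<Union>i\<in>to_nat_on P ` P. bowen_ball T (?n i) (?x i) \<delta>)" using assms(1,3) by auto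
  qed simp
  ultimately show ?thesis by simp
qed

lemma sum_le_packing_pre:
  assumes "finite E" "E \<subseteq> Z" "disjoint_family_on (\<lambda>x. bowen_cball T N x \<delta>) E"
  shows "(\<Sum>x\<in>E. ennreal (orbit_weight T f s \<delta> (N, x))) \<le> packing_pre T f Z s \<delta> N"
proof -
  obtain h where h: "bij_betw h {0..<card E} E"
    using ex_bij_betw_nat_finite[OF assms(1)] by blast
  have "(\<Sum>x\<in>E. ennreal (orbit_weight T f s \<delta> (N, x)))
      = family_sum T f s \<delta> {0..<card E} (\<lambda>_. N) h"
    unfolding family_sum_orbit_weight using sum.reindex_bij_betw[OF h, of "\<lambda>x. orbit_weight T f s \<delta> (N, x)"] by simp
  also have "\<dots> \<le> packing_pre T f Z s \<delta> N"
    unfolding packing_pre_def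
  proof (rule Sup_upper, intro CollectI exI conjI)
    show "\<forall>i\<in>{0..<card E}. N \<le> N \<and> h i \<in> Z"
      using h assms(2) by (auto simp: bij_betw_def)
    show "disjoint_family_on (\<lambda>i. bowen_cball T N (h i) \<delta>) {0..<card E}"
      using h assms(3) unfolding bij_betw_def disjoint_family_on_def inj_on_def by blast
  qed simp
  finally show ?thesis .
qed

section \<open>Bowen pressure bounded by packing pressure\<close>

text \<open>Disjoint balls contain distinct points of a finite cover, which bounds their number, so
  a family of maximal cardinality exists. By maximality the ball at any \<open>y\<close> in
  \<open>A\<close> meets a ball of the family, which puts \<open>y\<close> within
  \<open>2 * \<delta>\<close> of its centre.\<close>

lemma ex_maximal_disjoint_family:
  fixes T :: "'a::metric_space \<Rightarrow> 'a"
  assumes "compact (UNIV :: 'a set)" "continuous_on UNIV T" "0 < \<delta>"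
  obtains E where "finite E" "E \<subseteq> A" "disjoint_family_on (\<lambda>x. bowen_cball T n x \<delta>) E"
    "\<And>y. y \<in> A \<Longrightarrow> \<exists>e\<in>E. bowen_dist T n e y < 3 * \<delta>"
proof -
  obtain C where C: "finite C" "\<And>x. \<exists>c\<in>C. bowen_dist T n c x < \<delta>"
    using compact_finite_bowen_cover[OF assms] by blast
  define Q where
    "Q E \<longleftrightarrow> finite E \<and> E \<subseteq> A \<and> disjoint_family_on (\<lambda>x. bowen_cball T n x \<delta>) E" for E
  obtain c where c: "\<And>x. c x \<in> C" "\<And>x. bowen_dist T n (c x) x < \<delta>"
    using C(2) by metis
  have c_in: "c x \<in> bowen_cball T n x \<delta>" for x
    using c(2)[of x] assms(3)
    by (auto simp: bowen_cball_def bowen_dist_less_iff bowen_dist_le_iff dist_commute less_imp_le)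
  have "card E \<le> card C" if "Q E" for E
  proof (rule card_inj_on_le)
    show "inj_on c E"
      using that c_in unfolding Q_def disjoint_family_on_def inj_on_def
      by (metis Int_iff empty_iff)
  qed (use c C in auto)
  moreover have "Q {}" by (simp add: Q_def disjoint_family_on_def)
  ultimately have "\<exists>E. Q E \<and> (\<forall>E'. Q E' \<longrightarrow> card E' \<le> card E)"
    by (intro ex_has_greatest_nat[where k = "{}" and b = "Suc (card C)"]) (auto simp: less_Suc_eq_le)
  then obtain E where E: "Q E" "\<And>E'. Q E' \<Longrightarrow> card E' \<le> card E"
    by metis
  have "\<exists>e\<in>E. bowen_dist T n e y < 3 * \<delta>" if "y \<in> A" for y
  proof (rule ccontr)
    assume far: "\<not> (\<exists>e\<in>E. bowen_dist T n e y < 3 * \<delta>)"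
    have "y \<notin> E" using far assms(3) by (auto simp: bowen_dist_less_iff)
    have disj: "bowen_cball T n e \<delta> \<inter> bowen_cball T n y \<delta> = {}" if "e \<in> E" for e
    proof (rule ccontr)
      assume "bowen_cball T n e \<delta> \<inter> bowen_cball T n y \<delta> \<noteq> {}"
      then obtain z where z: "bowen_dist T n e z \<le> \<delta>" "bowen_dist T n y z \<le> \<delta>"
        by (auto simp: bowen_cball_def)
      have "dist ((T ^^ j) e) ((T ^^ j) y) < 3 * \<delta>" if "j < n" for j
      proof -
        have "dist ((T ^^ j) e) ((T ^^ j) z) \<le> \<delta>" "dist ((T ^^ j) y) ((T ^^ j) z) \<le> \<delta>"
          using z that assms(3) by (auto simp: bowen_dist_le_iff)
        then show ?thesis
          using dist_triangle2[of "(T ^^ j) e" "(T ^^ j) y" "(T ^^ j) z"] assms(3) by linarith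
      qed
      then show False using far that assms(3) by (auto simp: bowen_dist_less_iff)
    qed
    have "Q (insert y E)"
      using E(1) that disj by (auto simp: Q_def disjoint_family_on_def)
    then show False using E \<open>y \<notin> E\<close> by (force simp: Q_def)
  qed
  then show ?thesis using E(1) by (intro that[of E]) (auto simp: Q_def)
qed

text \<open>Tripling the radius of a maximal packing gives a cover. It changes
  \<open>ln (1 / \<delta>)\<close> by \<open>ln 3\<close>, hence each exponent by at most
  \<open>N * K * ln 3\<close>, which raising \<open>s\<close> by \<open>K * ln 3\<close>
  absorbs.\<close>

lemma bowen_cover_le_packing_pre:
  fixes T :: "'a::metric_space \<Rightarrow> 'a"
  assumes "compact (UNIV :: 'a set)" "continuous_on UNIV T" "0 < \<delta>"
    and K: "\<And>x. \<bar>f x\<bar> \<le> K"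
  obtains P where "finite P" "\<And>p. p \<in> P \<Longrightarrow> fst p = N"
    "A \<subseteq> (\<Union>p\<in>P. bowen_ball T (fst p) (snd p) (3 * \<delta>))"
    "(\<Sum>p\<in>P. ennreal (orbit_weight T f (s + K * ln 3) (3 * \<delta>) p)) \<le> packing_pre T f A s \<delta> N"
proof -
  obtain E where E: "finite E" "E \<subseteq> A" "disjoint_family_on (\<lambda>x. bowen_cball T N x \<delta>) E"
    "\<And>y. y \<in> A \<Longrightarrow> \<exists>e\<in>E. bowen_dist T N e y < 3 * \<delta>"
    using ex_maximal_disjoint_family[OF assms(1-3)] by blast
  have w: "orbit_weight T f (s + K * ln 3) (3 * \<delta>) (N, x) \<le> orbit_weight T f s \<delta> (N, x)" for x
  proof -
    have "- birkhoff_sum T f N x * ln 3 \<le> (real N * K) * ln 3"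
      using abs_birkhoff_sum_le[of f K T N x, OF K] by (intro mult_right_mono) auto
    moreover have ln3: "ln (1 / (3 * \<delta>)) = ln (1 / \<delta>) - ln 3"
      using assms(3) by (simp add: ln_div ln_mult)
    ultimately show ?thesis
      unfolding orbit_weight_def ln3 by (simp add: algebra_simps)
  qed
  show ?thesis
  proof (rule that[of "Pair N ` E"])
    have "(\<Sum>p\<in>Pair N ` E. ennreal (orbit_weight T f (s + K * ln 3) (3 * \<delta>) p))
        = (\<Sum>x\<in>E. ennreal (orbit_weight T f (s + K * ln 3) (3 * \<delta>) (N, x)))"
      by (subst sum.reindex) (auto simp: inj_on_def)
    also have "\<dots> \<le> (\<Sum>x\<in>E. ennreal (orbit_weight T f s \<delta> (N, x)))"
      by (intro sum_mono ennreal_leI w)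
    also have "\<dots> \<le> packing_pre T f A s \<delta> N"
      by (rule sum_le_packing_pre[OF E(1-3)])
    finally show "(\<Sum>p\<in>Pair N ` E. ennreal (orbit_weight T f (s + K * ln 3) (3 * \<delta>) p))
      \<le> packing_pre T f A s \<delta> N" .
  qed (use E in \<open>auto simp: bowen_ball_def\<close>)
qed

text \<open>Zero packing measure splits \<open>Z\<close> into sets \<open>A i\<close> of small total
  premeasure. Each is covered at its own length \<open>M i\<close>; since Bowen covers may mix
  lengths, the union is an admissible cover of \<open>Z\<close>.\<close>

lemma bowen_pressure_le_packing_pressure:
  fixes T :: "'a::metric_space \<Rightarrow> 'a"
  assumes "compact (UNIV :: 'a set)" "continuous_on UNIV T" "0 < \<delta>"
    and K: "\<And>x. \<bar>f x\<bar> \<le> K"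
    and less: "packing_pressure T f Z \<delta> < ereal s"
  shows "bowen_pressure T f Z (3 * \<delta>) \<le> ereal (s + K * ln 3)"
proof -
  obtain s' where s': "s' < s" "packing_measure T f Z s' \<delta> = 0"
    using less by (auto simp: packing_pressure_def Inf_less_iff)
  let ?t = "s' + K * ln 3"
  have small: "bowen_pre T f Z ?t (3 * \<delta>) N \<le> ennreal e" if "e > 0" for N e
  proof -
    have "packing_measure T f Z s' \<delta> < ennreal (e / 2)"
      using s'(2) that by simp
    then obtain A :: "nat \<Rightarrow> 'a set" where A: "Z \<subseteq> (\<Union>i. A i)"
        "(\<Sum>i. packing_premeasure T f (A i) s' \<delta>) < ennreal (e / 2)"
      unfolding packing_measure_def INF_less_iff by blast
    \<comment> \<open>The geometric slack makes room for choosing \<open>M i\<close> and sums to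
      \<open>e / 2\<close> over all \<open>i\<close>.\<close>
    define c where
      "c i = packing_premeasure T f (A i) s' \<delta> + ennreal (e / 2 * (1 / 2) ^ Suc i)" for i
    have "\<exists>M\<ge>N. packing_pre T f (A i) s' \<delta> M \<le> c i" for i
    proof -
      \<comment> \<open>Finiteness of each term is what makes adding the slack a strict
        increase.\<close>
      have "packing_premeasure T f (A i) s' \<delta> \<le> (\<Sum>i. packing_premeasure T f (A i) s' \<delta>)"
        using sum_le_suminf[of "\<lambda>i. packing_premeasure T f (A i) s' \<delta>" "{i}"] by simp
      then have "packing_premeasure T f (A i) s' \<delta> < top"
        using A(2) by (metis ennreal_less_top order.strict_trans order.strict_trans1)
      then have "packing_premeasure T f (A i) s' \<delta> < c i"
        using that unfolding c_def
        by (cases "packing_premeasure T f (A i) s' \<delta>") (auto simp: ennreal_less_iff simp flip: ennreal_plus)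
      then obtain M where "packing_pre T f (A i) s' \<delta> M < c i"
        by (auto simp: packing_premeasure_eq_INF INF_less_iff)
      then have "packing_pre T f (A i) s' \<delta> (max N M) \<le> c i"
        by (intro order_trans[OF packing_pre_antimono[of M "max N M"]]) auto
      then show ?thesis by (intro exI[of _ "max N M"]) auto
    qed
    then obtain M where M: "\<And>i. M i \<ge> N" "\<And>i. packing_pre T f (A i) s' \<delta> (M i) \<le> c i"
      by metis
    have "\<exists>P. \<forall>i. finite (P i) \<and> (\<forall>p\<in>P i. fst p = M i) \<and>
        A i \<subseteq> (\<Union>p\<in>P i. bowen_ball T (fst p) (snd p) (3 * \<delta>)) \<and>
        (\<Sum>p\<in>P i. ennreal (orbit_weight T f ?t (3 * \<delta>) p)) \<le> c i"
    proof (rule choice, rule allI)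
      fix i
      show "\<exists>P. finite P \<and> (\<forall>p\<in>P. fst p = M i) \<and>
          A i \<subseteq> (\<Union>p\<in>P. bowen_ball T (fst p) (snd p) (3 * \<delta>)) \<and>
          (\<Sum>p\<in>P. ennreal (orbit_weight T f ?t (3 * \<delta>) p)) \<le> c i"
        by (rule bowen_cover_le_packing_pre[where f = f and N = "M i" and A = "A i" and s = s', OF assms(1-3) K])
          (meson M(2) order_trans)
    qed
    then obtain P where P: "\<And>i. finite (P i)" "\<And>i p. p \<in> P i \<Longrightarrow> fst p = M i"
        "\<And>i. A i \<subseteq> (\<Union>p\<in>P i. bowen_ball T (fst p) (snd p) (3 * \<delta>))"
        "\<And>i. (\<Sum>p\<in>P i. ennreal (orbit_weight T f ?t (3 * \<delta>) p)) \<le> c i"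
      by meson
    have "bowen_pre T f Z ?t (3 * \<delta>) N
        \<le> (\<Sum>\<^sub>\<infinity>p\<in>(\<Union>i. P i). ennreal (orbit_weight T f ?t (3 * \<delta>) p))"
    proof (rule bowen_pre_le_infsum)
      show "Z \<subseteq> (\<Union>p\<in>(\<Union>i. P i). bowen_ball T (fst p) (snd p) (3 * \<delta>))"
        using A(1) P(3) by blast
      show "N \<le> fst p" if "p \<in> (\<Union>i. P i)" for p
        using that by (elim UN_E) (metis P(2) M(1))
    qed (use P(1) in \<open>auto intro: countable_finite\<close>)
    also have "\<dots> \<le> (\<Sum>i. c i)"
      using P(1,4) by (rule infsum_UN_ennreal_le)
    also have "\<dots> = (\<Sum>i. packing_premeasure T f (A i) s' \<delta>)
        + (\<Sum>i. ennreal (e / 2 * (1 / 2) ^ Suc i))"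
      unfolding c_def by (rule suminf_add[symmetric]) auto
    also have "(\<Sum>i. ennreal (e / 2 * (1 / 2) ^ Suc i)) = ennreal (e / 2)"
      using that sums_mult[OF power_half_series, of "e / 2"] by (intro suminf_ennreal_eq) auto
    also have "(\<Sum>i. packing_premeasure T f (A i) s' \<delta>) + ennreal (e / 2)
        \<le> ennreal (e / 2) + ennreal (e / 2)"
      using A(2) by (intro add_right_mono) simp
    also have "\<dots> = ennreal e"
      using that by (simp flip: ennreal_plus)
    finally show ?thesis .
  qed
  have "bowen_pre T f Z ?t (3 * \<delta>) N \<le> 0" for N
    by (rule ennreal_le_epsilon) (simp only: add_0 small)
  then have "bowen_measure T f Z ?t (3 * \<delta>) = 0"
    by (simp add: bowen_measure_eq_SUP)
  then have "bowen_pressure T f Z (3 * \<delta>) \<le> ereal ?t"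
    unfolding bowen_pressure_def by (intro Inf_lower) auto
  also have "\<dots> \<le> ereal (s + K * ln 3)" using s'(1) by simp
  finally show ?thesis .
qed

section \<open>Packing pressure bounded by spanning pressure\<close>

lemma eventually_span_sum_le:
  assumes "span_pressure T f Z \<delta> < ereal t"
  shows "\<forall>\<^sub>F n in sequentially. span_sum T f Z \<delta> n \<le> ennreal (exp (real n * t))"
  using Limsup_lessD[OF assms[unfolded span_pressure_def]] eventually_gt_at_top[of 0]
proof eventually_elim
  case (elim n)
  then have "ext_ln (span_sum T f Z \<delta> n) < ereal (real n * t)"
    by (cases "ext_ln (span_sum T f Z \<delta> n)") (auto simp: field_simps)
  then show ?case by (rule ext_ln_lessD)
qed

text \<open>After division by \<open>n\<close> the overhead \<open>B\<close> tends to 0, so only the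
  linear rate \<open>t\<close> survives.\<close>

lemma span_pressure_le:
  assumes "\<And>n. 0 < n \<Longrightarrow> span_sum T f Z \<delta> n \<le> ennreal (exp (B + real n * t))"
  shows "span_pressure T f Z \<delta> \<le> ereal t"
proof -
  have "\<forall>\<^sub>F n in sequentially.
      ereal (1 / real n) * ext_ln (span_sum T f Z \<delta> n) \<le> ereal (B / real n + t)"
    using eventually_gt_at_top[of 0]
  proof eventually_elim
    case (elim n)
    have "ereal (1 / real n) * ext_ln (span_sum T f Z \<delta> n)
        \<le> ereal (1 / real n) * ereal (B + real n * t)"
      using elim assms by (intro ereal_mult_left_mono ext_ln_le_ereal) auto
    then show ?case using elim by (simp add: field_simps)
  qed
  then have "span_pressure T f Z \<delta> \<le> limsup (\<lambda>n. ereal (B / real n + t))"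
    unfolding span_pressure_def by (rule Limsup_mono)
  also have "(\<lambda>n. ereal (B / real n + t)) \<longlonglongrightarrow> ereal t"
    by (intro tendsto_intros tendsto_eq_intros lim_const_over_n) auto
  then have "limsup (\<lambda>n. ereal (B / real n + t)) = ereal t"
    by (intro lim_imp_Limsup) auto
  finally show ?thesis .
qed

text \<open>Each disjoint closed ball contains its own point of the spanning set, so the choice is
  injective. Moving from the centre to that point changes the Birkhoff sum by at most
  \<open>n * \<eta>\<close>, which the parameter \<open>\<eta> * ln (1 / \<delta>)\<close> pays
  for.\<close>

lemma sum_disjoint_le_span_sum:
  assumes \<delta>: "0 < \<delta>" "\<delta> < 1"
    and osc: "\<And>x y. dist x y \<le> \<delta> \<Longrightarrow> \<bar>f x - f y\<bar> \<le> \<eta>"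
    and J: "finite J" "\<And>i. i \<in> J \<Longrightarrow> x i \<in> Z"
    and disj: "disjoint_family_on (\<lambda>i. bowen_cball T n (x i) \<delta>) J"
  shows "(\<Sum>i\<in>J. ennreal (orbit_weight T f (\<eta> * ln (1 / \<delta>)) \<delta> (n, x i))) \<le> span_sum T f Z \<delta> n"
  unfolding span_sum_def
proof (rule INF_greatest)
  have q: "ln (1 / \<delta>) > 0" using \<delta> by simp
  fix E assume "E \<in> {E. spanning_set T n \<delta> Z E}"
  then have "\<forall>i\<in>J. \<exists>y\<in>E. bowen_dist T n (x i) y < \<delta>"
    using J(2) by (auto simp: spanning_set_def)
  then obtain y where y: "\<And>i. i \<in> J \<Longrightarrow> y i \<in> E" "\<And>i. i \<in> J \<Longrightarrow> bowen_dist T n (x i) (y i) < \<delta>"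
    by metis
  have "inj_on y J"
  proof (rule inj_onI, rule ccontr)
    fix i j assume ij: "i \<in> J" "j \<in> J" "y i = y j" "i \<noteq> j"
    then have "y i \<in> bowen_cball T n (x i) \<delta> \<inter> bowen_cball T n (x j) \<delta>"
      using y(2)[of i] y(2)[of j] by (auto simp: bowen_cball_def)
    then show False using disj ij by (auto simp: disjoint_family_on_def)
  qed
  have "orbit_weight T f (\<eta> * ln (1 / \<delta>)) \<delta> (n, x i) \<le> (1 / \<delta>) powr birkhoff_sum T f n (y i)"
    if i: "i \<in> J" for i
  proof -
    have "birkhoff_sum T f n (x i) \<le> birkhoff_sum T f n (y i) + real n * \<eta>"
      using y(2)[OF i] \<delta>(1)
      by (intro birkhoff_sum_close[where \<delta> = \<delta>] osc) (auto simp: bowen_dist_less_iff less_imp_le)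
    then have "ln (1 / \<delta>) * birkhoff_sum T f n (x i)
        \<le> ln (1 / \<delta>) * (birkhoff_sum T f n (y i) + real n * \<eta>)"
      using q by (intro mult_left_mono) auto
    then show ?thesis
      using \<delta> by (simp add: orbit_weight_def powr_def algebra_simps)
  qed
  then have "(\<Sum>i\<in>J. ennreal (orbit_weight T f (\<eta> * ln (1 / \<delta>)) \<delta> (n, x i)))
      \<le> (\<Sum>i\<in>J. ennreal ((1 / \<delta>) powr birkhoff_sum T f n (y i)))"
    by (intro sum_mono ennreal_leI)
  also have "\<dots> = (\<Sum>x\<in>y ` J. ennreal ((1 / \<delta>) powr birkhoff_sum T f n x))"
    using \<open>inj_on y J\<close> by (simp add: sum.reindex)
  also have "\<dots> \<le> (\<Sum>\<^sub>\<infinity>x\<in>E. ennreal ((1 / \<delta>) powr birkhoff_sum T f n x))"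
    using y(1) J(1) by (intro sum_le_infsum_ennreal) auto
  finally show "(\<Sum>i\<in>J. ennreal (orbit_weight T f (\<eta> * ln (1 / \<delta>)) \<delta> (n, x i)))
      \<le> (\<Sum>\<^sub>\<infinity>x\<in>E. ennreal ((1 / \<delta>) powr birkhoff_sum T f n x))" .
qed

lemma packing_pressure_le_span_pressure:
  assumes \<delta>: "0 < \<delta>" "\<delta> < 1"
    and osc: "\<And>x y. dist x y \<le> \<delta> \<Longrightarrow> \<bar>f x - f y\<bar> \<le> \<eta>"
    and less: "span_pressure T f Z \<delta> < ereal s"
  shows "packing_pressure T f Z \<delta> \<le> ereal (s + \<eta> * ln (1 / \<delta>))"
proof -
  let ?s = "s + \<eta> * ln (1 / \<delta>)"
  \<comment> \<open>A rate strictly between leaves a ratio \<open>r < 1\<close> per unit of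
    length.\<close>
  obtain t where t: "span_pressure T f Z \<delta> < ereal t" "ereal t < ereal s"
    using ereal_dense2[OF less] by blast
  obtain N0 where N0: "\<And>n. N0 \<le> n \<Longrightarrow> span_sum T f Z \<delta> n \<le> ennreal (exp (real n * t))"
    using eventually_span_sum_le[OF t(1)] by (auto simp: eventually_sequentially)
  define r where "r = exp (t - s)"
  have r: "0 \<le> r" "r < 1" using t(2) by (auto simp: r_def)
  have pre: "packing_pre T f Z ?s \<delta> N \<le> ennreal (r ^ N / (1 - r))" if "N0 \<le> N" for N
    unfolding packing_pre_def
  proof (rule Sup_least, safe)
    fix I :: "nat set" and n x
    assume I: "\<forall>i\<in>I. N \<le> n i \<and> x i \<in> Z"
      and disj: "disjoint_family_on (\<lambda>i. bowen_cball T (n i) (x i) \<delta>) I"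
    show "family_sum T f ?s \<delta> I n x \<le> ennreal (r ^ N / (1 - r))"
      unfolding family_sum_orbit_weight
    proof (rule infsum_ennreal_le)
      fix J assume J: "finite J" "J \<subseteq> I"
      \<comment> \<open>Spanning sums compare balls of one length only, so the packing is sorted by
        length.\<close>
      have level: "(\<Sum>i\<in>{i\<in>J. n i = k}. ennreal (orbit_weight T f ?s \<delta> (n i, x i))) \<le> ennreal (r ^ k)"
        if k: "N \<le> k" for k
      proof -
        have "(\<Sum>i\<in>{i\<in>J. n i = k}. ennreal (orbit_weight T f ?s \<delta> (n i, x i)))
            = (\<Sum>i\<in>{i\<in>J. n i = k}. ennreal (exp (- real k * s)) *
                ennreal (orbit_weight T f (\<eta> * ln (1 / \<delta>)) \<delta> (k, x i)))"
          by (intro sum.cong refl)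
            (auto simp: orbit_weight_def algebra_simps simp flip: ennreal_mult exp_add)
        also have "\<dots> = ennreal (exp (- real k * s)) *
            (\<Sum>i\<in>{i\<in>J. n i = k}. ennreal (orbit_weight T f (\<eta> * ln (1 / \<delta>)) \<delta> (k, x i)))"
          by (simp only: sum_distrib_left)
        also have "\<dots> \<le> ennreal (exp (- real k * s)) * span_sum T f Z \<delta> k"
        proof (intro mult_left_mono sum_disjoint_le_span_sum[OF \<delta> osc])
          have "disjoint_family_on (\<lambda>i. bowen_cball T (n i) (x i) \<delta>) {i\<in>J. n i = k}"
            by (rule disjoint_family_on_mono[OF _ disj]) (use J(2) in auto)
          then show "disjoint_family_on (\<lambda>i. bowen_cball T k (x i) \<delta>) {i\<in>J. n i = k}"
            by (simp add: disjoint_family_on_def)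
        qed (use I J in auto)
        also have "\<dots> \<le> ennreal (exp (- real k * s)) * ennreal (exp (real k * t))"
          using N0 that \<open>N0 \<le> N\<close> by (intro mult_left_mono) auto
        also have "\<dots> = ennreal (r ^ k)"
          by (simp add: r_def algebra_simps exp_of_nat_mult[symmetric] flip: ennreal_mult exp_add)
        finally show ?thesis .
      qed
      have "(\<Sum>i\<in>J. ennreal (orbit_weight T f ?s \<delta> (n i, x i)))
          = (\<Sum>k\<in>n ` J. \<Sum>i\<in>{i\<in>J. n i = k}. ennreal (orbit_weight T f ?s \<delta> (n i, x i)))"
        by (rule sum.image_gen[OF J(1)])
      also have "\<dots> \<le> (\<Sum>k\<in>n ` J. ennreal (r ^ k))"
        using I J(2) by (intro sum_mono level) auto
      also have "\<dots> = ennreal (\<Sum>k\<in>n ` J. r ^ k)"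
        using r by (intro sum_ennreal) auto
      also have "\<dots> \<le> ennreal (r ^ N / (1 - r))"
        using r I J by (intro ennreal_leI sum_power_tail_le) auto
      finally show "(\<Sum>i\<in>J. ennreal (orbit_weight T f ?s \<delta> (n i, x i))) \<le> ennreal (r ^ N / (1 - r))" .
    qed
  qed
  have "(\<lambda>N. ennreal (r ^ N / (1 - r))) \<longlonglongrightarrow> ennreal (0 / (1 - r))"
    using r by (intro tendsto_ennrealI tendsto_divide tendsto_const LIMSEQ_power_zero) auto
  then have "packing_premeasure T f Z ?s \<delta> \<le> ennreal (0 / (1 - r))"
    unfolding packing_premeasure_eq_INF
    by (rule LIMSEQ_le_const) (meson INF_lower2 UNIV_I pre)
  then have zero: "packing_premeasure T f Z ?s \<delta> = 0" by simp
  \<comment> \<open>The trivial decomposition: \<open>Z\<close> itself, padded with empty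
    sets.\<close>
  have "packing_measure T f Z ?s \<delta>
      \<le> (\<Sum>i. packing_premeasure T f ((\<lambda>i::nat. if i = 0 then Z else {}) i) ?s \<delta>)"
    unfolding packing_measure_def by (rule INF_lower) (auto split: if_splits)
  also have "(\<lambda>i::nat. packing_premeasure T f (if i = 0 then Z else {}) ?s \<delta>) = (\<lambda>_. 0)"
    by (auto simp: zero packing_premeasure_empty)
  finally have "packing_measure T f Z ?s \<delta> = 0" by simp
  then show ?thesis unfolding packing_pressure_def by (intro Inf_lower) auto
qed

section \<open>Covering the whole space from covers of local stable sets\<close>

text \<open>Some \<open>s' < s\<close> has measure zero, hence covers of weight below 1 at every
  level \<open>N\<close>; the balls are open and \<open>Z\<close> is compact, so finitely many
  suffice.\<close>

lemma bowen_pressure_finite_cover: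
  fixes T :: "'a::metric_space \<Rightarrow> 'a"
  assumes "compact Z" "continuous_on UNIV T" "0 < \<delta>"
    and less: "bowen_pressure T f Z \<delta> < ereal s"
  obtains P where "finite P" "\<And>p. p \<in> P \<Longrightarrow> N \<le> fst p"
    "Z \<subseteq> (\<Union>p\<in>P. bowen_ball T (fst p) (snd p) \<delta>)" "(\<Sum>p\<in>P. orbit_weight T f s \<delta> p) \<le> 1"
proof -
  obtain s' where s': "s' < s" "bowen_measure T f Z s' \<delta> = 0"
    using less by (auto simp: bowen_pressure_def Inf_less_iff)
  then have "bowen_pre T f Z s' \<delta> N = 0"
    unfolding bowen_measure_eq_SUP by (metis SUP_upper UNIV_I le_zero_eq)
  then have "bowen_pre T f Z s' \<delta> N < 1" by simp
  then obtain I n x where I: "family_sum T f s' \<delta> I n x < 1" "\<And>i. i \<in> I \<Longrightarrow> N \<le> n i"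
      "Z \<subseteq> (\<Union>i\<in>I. bowen_ball T (n i) (x i) \<delta>)"
    unfolding bowen_pre_def Inf_less_iff by blast
  obtain J where J: "J \<subseteq> I" "finite J" "Z \<subseteq> (\<Union>i\<in>J. bowen_ball T (n i) (x i) \<delta>)"
    by (rule compactE_image[OF assms(1) _ I(3)]) (auto intro: open_bowen_ball assms(2,3))
  let ?P = "(\<lambda>i. (n i, x i)) ` J"
  have "(\<Sum>i\<in>J. ennreal (orbit_weight T f s' \<delta> (n i, x i))) < 1"
    using sum_le_infsum_ennreal[OF J(2,1)] I(1) unfolding family_sum_orbit_weight
    by (rule order.strict_trans1)
  then have "ennreal (\<Sum>i\<in>J. orbit_weight T f s' \<delta> (n i, x i)) < ennreal 1"
    by simp
  then have *: "(\<Sum>i\<in>J. orbit_weight T f s' \<delta> (n i, x i)) < 1"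
    by (subst (asm) ennreal_less_iff) (auto intro: sum_nonneg)
  have "(\<Sum>p\<in>?P. orbit_weight T f s \<delta> p) \<le> (\<Sum>p\<in>?P. orbit_weight T f s' \<delta> p)"
    using s'(1) by (intro sum_mono) (auto simp: orbit_weight_def intro!: mult_left_mono)
  \<comment> \<open>Only an inequality, since different indices may carry the same pair.\<close>
  also have "\<dots> \<le> (\<Sum>i\<in>J. orbit_weight T f s' \<delta> (n i, x i))"
    using sum_image_le[OF J(2), of "orbit_weight T f s' \<delta>" "\<lambda>i. (n i, x i)"] by (simp add: o_def)
  finally have "(\<Sum>p\<in>?P. orbit_weight T f s \<delta> p) \<le> 1" using * by linarith
  then show ?thesis
    using I(2) J by (intro that[of ?P]) auto
qed

text \<open>Otherwise there are \<open>y m\<close> tending to \<open>x\<close> and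
  \<open>z m\<close> in \<open>bowen_cball T m (y m) \<epsilon>\<close> outside \<open>U\<close>. A
  subsequential limit of \<open>z\<close> satisfies the distance bound at every time, so it lies in
  the stable set and thus in \<open>U\<close>, yet also in the closed complement of
  \<open>U\<close>.\<close>

lemma bowen_cball_subset_nhd:
  fixes T :: "'a::metric_space \<Rightarrow> 'a"
  assumes "compact (UNIV :: 'a set)" "continuous_on UNIV T" "0 \<le> \<epsilon>"
    and U: "open U" "stable_set T \<epsilon> UNIV x \<subseteq> U"
  shows "\<exists>m. \<forall>y. dist x y < inverse (real (Suc m)) \<longrightarrow> bowen_cball T m y \<epsilon> \<subseteq> U"
proof (rule ccontr)
  assume "\<not> ?thesis"
  then have "\<forall>m. \<exists>y z. dist x y < inverse (real (Suc m)) \<and> z \<in> bowen_cball T m y \<epsilon> \<and> z \<notin> U"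
    by blast
  then obtain y z where yz: "\<And>m. dist x (y m) < inverse (real (Suc m))"
      "\<And>m. z m \<in> bowen_cball T m (y m) \<epsilon>" "\<And>m. z m \<notin> U"
    by metis
  obtain l r where r: "strict_mono r" "(z \<circ> r) \<longlonglongrightarrow> l"
    using assms(1) unfolding compact_def by (metis UNIV_I)
  have "(\<lambda>m. dist (y m) x) \<longlonglongrightarrow> 0"
  proof (rule tendsto_sandwich[OF _ _ tendsto_const LIMSEQ_inverse_real_of_nat])
    show "\<forall>\<^sub>F m in sequentially. dist (y m) x \<le> inverse (real (Suc m))"
      using yz(1) by (intro always_eventually allI) (metis dist_commute less_imp_le)
  qed auto
  then have "y \<longlonglongrightarrow> x" by (subst tendsto_dist_iff)
  then have y: "(y \<circ> r) \<longlonglongrightarrow> x" using r(1) by (rule LIMSEQ_subseq_LIMSEQ)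
  have cont: "isCont (T ^^ j) a" for j a
    using continuous_on_funpow_UNIV[OF assms(2)] by (simp add: continuous_on_eq_continuous_at)
  have "dist ((T ^^ j) x) ((T ^^ j) l) \<le> \<epsilon>" for j
  proof (rule LIMSEQ_le_const2)
    show "(\<lambda>k. dist ((T ^^ j) ((y \<circ> r) k)) ((T ^^ j) ((z \<circ> r) k)))
        \<longlonglongrightarrow> dist ((T ^^ j) x) ((T ^^ j) l)"
      by (intro tendsto_dist isCont_tendsto_compose[OF cont] y r(2))
    show "\<exists>N. \<forall>k\<ge>N. dist ((T ^^ j) ((y \<circ> r) k)) ((T ^^ j) ((z \<circ> r) k)) \<le> \<epsilon>"
    \<comment> \<open>Time \<open>j\<close> is controlled once \<open>j < r k\<close>, and
      \<open>k \<le> r k\<close> for a strictly increasing \<open>r\<close>.\<close>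
    proof (intro exI[of _ "Suc j"] allI impI)
      fix k assume "Suc j \<le> k"
      then have "j < r k" using seq_suble[OF r(1), of k] by linarith
      then show "dist ((T ^^ j) ((y \<circ> r) k)) ((T ^^ j) ((z \<circ> r) k)) \<le> \<epsilon>"
        using yz(2)[of "r k"] assms(3) by (simp add: bowen_cball_def bowen_dist_le_iff)
    qed
  qed
  then have "l \<in> U" using U(2) by (auto simp: stable_set_def)
  moreover have "l \<in> - U"
    using closed_sequentially[of "- U" "z \<circ> r" l] U(1) yz(3) r(2) by (auto simp: closed_Compl)
  ultimately show False by simp
qed

lemma bowen_cball_antimono:
  assumes "m \<le> n" "0 \<le> \<epsilon>"
  shows "bowen_cball T n x \<epsilon> \<subseteq> bowen_cball T m x \<epsilon>"
  using assms by (auto simp: bowen_cball_def bowen_dist_le_iff)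

text \<open>Each stable set has a cover that serves all nearby centres; finitely many neighbourhoods
  exhaust the space, and maxima over them give \<open>m\<close> and \<open>M\<close>.\<close>

lemma uniform_finite_cover:
  fixes T :: "'a::metric_space \<Rightarrow> 'a"
  assumes "compact (UNIV :: 'a set)" "continuous_on UNIV T" "0 \<le> \<epsilon>" "0 < \<delta>"
    and less: "\<And>x. bowen_pressure T f (stable_set T \<epsilon> UNIV x) \<delta> < ereal s"
  shows "\<exists>m M. \<forall>y. \<exists>P. finite P \<and> (\<forall>p\<in>P. 1 \<le> fst p \<and> fst p \<le> M) \<and>
    bowen_cball T m y \<epsilon> \<subseteq> (\<Union>p\<in>P. bowen_ball T (fst p) (snd p) \<delta>) \<and>
    (\<Sum>p\<in>P. orbit_weight T f s \<delta> p) \<le> 1"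
proof -
  define good where "good x P m \<longleftrightarrow> finite P \<and> (\<forall>p\<in>P. 1 \<le> fst p) \<and>
    (\<forall>y. dist x y < inverse (real (Suc m)) \<longrightarrow>
      bowen_cball T m y \<epsilon> \<subseteq> (\<Union>p\<in>P. bowen_ball T (fst p) (snd p) \<delta>)) \<and>
    (\<Sum>p\<in>P. orbit_weight T f s \<delta> p) \<le> 1" for x P m
  have "\<exists>P m. good x P m" for x
  proof -
    have "compact (stable_set T \<epsilon> UNIV x)"
      using compact_Int_closed[OF assms(1) closed_stable_set[OF assms(2)]] by simp
    \<comment> \<open>Lengths of at least 1 make the later induction along orbits decrease.\<close>
    from bowen_pressure_finite_cover[OF this assms(2,4) less, where N = 1]
    obtain P where P: "finite P" "\<And>p. p \<in> P \<Longrightarrow> 1 \<le> fst p"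
      "stable_set T \<epsilon> UNIV x \<subseteq> (\<Union>p\<in>P. bowen_ball T (fst p) (snd p) \<delta>)"
      "(\<Sum>p\<in>P. orbit_weight T f s \<delta> p) \<le> 1" by metis
    have "open (\<Union>p\<in>P. bowen_ball T (fst p) (snd p) \<delta>)"
      by (intro open_UN ballI open_bowen_ball assms(2,4))
    from bowen_cball_subset_nhd[OF assms(1-3) this P(3)] P show ?thesis
      unfolding good_def by metis
  qed
  then obtain P0 m where good: "\<And>x. good x (P0 x) (m x)" by metis
  obtain D where D: "D \<subseteq> UNIV" "finite D" "UNIV \<subseteq> (\<Union>x\<in>D. ball x (inverse (real (Suc (m x)))))"
    by (rule compactE_image[OF assms(1), where C = UNIV and f = "\<lambda>x. ball x (inverse (real (Suc (m x))))"])
      auto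
  show ?thesis
  proof (rule exI, rule exI, rule allI)
    fix y
    obtain x where x: "x \<in> D" "dist x y < inverse (real (Suc (m x)))"
      using D(3) by (auto simp: subset_iff)
    have "m x \<le> Max (m ` D)" using D(2) x(1) by auto
    then have "bowen_cball T (Max (m ` D)) y \<epsilon> \<subseteq> bowen_cball T (m x) y \<epsilon>"
      using assms(3) by (rule bowen_cball_antimono)
    also have "\<dots> \<subseteq> (\<Union>p\<in>P0 x. bowen_ball T (fst p) (snd p) \<delta>)"
      using good[of x] x(2) unfolding good_def by blast
    finally have "bowen_cball T (Max (m ` D)) y \<epsilon> \<subseteq> (\<Union>p\<in>P0 x. bowen_ball T (fst p) (snd p) \<delta>)" .
    moreover have "fst p \<le> Max (fst ` (\<Union>x\<in>D. P0 x))" if "p \<in> P0 x" for p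
      using D(2) x(1) that good unfolding good_def by (intro Max_ge finite_imageI finite_UN_I) auto
    ultimately show "\<exists>P. finite P \<and> (\<forall>p\<in>P. 1 \<le> fst p \<and> fst p \<le> Max (fst ` (\<Union>x\<in>D. P0 x))) \<and>
        bowen_cball T (Max (m ` D)) y \<epsilon> \<subseteq> (\<Union>p\<in>P. bowen_ball T (fst p) (snd p) \<delta>) \<and>
        (\<Sum>p\<in>P. orbit_weight T f s \<delta> p) \<le> 1"
      using good[of x] unfolding good_def by (intro exI[of _ "P0 x"]) auto
  qed
qed

section \<open>Concatenation of local covers along orbits\<close>

text \<open>A set with a weight that, up to the allowed growth, bounds the exponential Birkhoff sum
  at all its points: any point may later represent the piece in a spanning set at scale
  \<open>2 * \<delta>\<close>.\<close>

definition bowen_piece ::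
    "('a::metric_space \<Rightarrow> 'a) \<Rightarrow> ('a \<Rightarrow> real) \<Rightarrow> real \<Rightarrow> real \<Rightarrow> real \<Rightarrow> nat \<Rightarrow> 'a set \<times> real \<Rightarrow> bool" where
  "bowen_piece T f \<delta> B t n Aw \<longleftrightarrow> 0 \<le> snd Aw \<and>
     (\<forall>y\<in>fst Aw. \<forall>z\<in>fst Aw. bowen_dist T n y z < 2 * \<delta>) \<and>
     (\<forall>y\<in>fst Aw. exp (ln (1 / \<delta>) * birkhoff_sum T f n y) \<le> exp (B + real n * t) * snd Aw)"

text \<open>
  A point of \<open>bowen_cball T (n + m) x \<epsilon>\<close> lies in some ball of length \<open>n\<^sub>1\<close>, and after \<open>n\<^sub>1\<close> steps
  it lies in \<open>bowen_cball T (n - n\<^sub>1 + m) (T\<^bsup>n\<^sub>1\<^esup> x) \<epsilon>\<close>: the local covers can be concatenated.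
  Their weights multiply, so the total weight stays at most \<open>1\<close>.
\<close>

lemma bowen_cball_pieces:
  fixes T :: "'a::metric_space \<Rightarrow> 'a"
  assumes \<delta>: "0 < \<delta>" "\<delta> < 1" and "0 \<le> \<epsilon>" "0 \<le> \<eta>"
    and osc: "\<And>x y. dist x y \<le> \<delta> \<Longrightarrow> \<bar>f x - f y\<bar> \<le> \<eta>"
    and K: "\<And>x. \<bar>f x\<bar> \<le> K"
    and cover: "\<And>y. \<exists>P. finite P \<and> (\<forall>p\<in>P. 1 \<le> fst p \<and> fst p \<le> M) \<and>
      bowen_cball T m y \<epsilon> \<subseteq> (\<Union>p\<in>P. bowen_ball T (fst p) (snd p) \<delta>) \<and>
      (\<Sum>p\<in>P. orbit_weight T f s \<delta> p) \<le> 1"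
  defines "t \<equiv> s + \<eta> * ln (1 / \<delta>)"
    and "B \<equiv> real M * (\<bar>s\<bar> + \<eta> * ln (1 / \<delta>) + K * ln (1 / \<delta>))"
  shows "\<exists>xs. bowen_cball T (n + m) x \<epsilon> \<subseteq> \<Union> (fst ` set xs) \<and>
    (\<forall>Aw\<in>set xs. bowen_piece T f \<delta> B t n Aw) \<and> sum_list (map snd xs) \<le> 1"
proof (induction n arbitrary: x rule: less_induct)
  case (less n)
  let ?q = "ln (1 / \<delta>)"
  have q: "0 < ?q" using \<delta> by simp
  have K0: "0 \<le> K" using K[of undefined] by linarith
  have B0: "0 \<le> B" unfolding B_def using q K0 \<open>0 \<le> \<eta>\<close> by simp
  show ?case
  proof (cases "n = 0")
    case True
    \<comment> \<open>At length 0 all distances and Birkhoff sums vanish, so the whole space with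
      weight 1 is a single piece.\<close>
    then show ?thesis
      using B0 \<delta>(1)
      by (intro exI[of _ "[(UNIV, 1)]"]) (auto simp: bowen_piece_def bowen_dist_def birkhoff_sum_def)
  next
    case False
    obtain P where P: "finite P" "\<And>p. p \<in> P \<Longrightarrow> 1 \<le> fst p" "\<And>p. p \<in> P \<Longrightarrow> fst p \<le> M"
        "bowen_cball T m x \<epsilon> \<subseteq> (\<Union>p\<in>P. bowen_ball T (fst p) (snd p) \<delta>)"
        "(\<Sum>p\<in>P. orbit_weight T f s \<delta> p) \<le> 1"
      using cover[of x] by blast
    have "\<exists>ys. bowen_cball T (n + m) x \<epsilon> \<inter> bowen_ball T (fst p) (snd p) \<delta> \<subseteq> \<Union> (fst ` set ys) \<and>
        (\<forall>Aw\<in>set ys. bowen_piece T f \<delta> B t n Aw) \<and> sum_list (map snd ys) \<le> orbit_weight T f s \<delta> p"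
      if p: "p \<in> P" for p
    proof -
      obtain k c where pkc: "p = (k, c)" by (cases p)
      let ?b = "bowen_ball T k c \<delta>"
      have k: "1 \<le> k" "k \<le> M" using P(2,3)[OF p] by (auto simp: pkc)
      have near: "dist ((T ^^ j) y) ((T ^^ j) z) < 2 * \<delta>" if "y \<in> ?b" "z \<in> ?b" "j < k" for y z j
      proof -
        have "dist ((T ^^ j) c) ((T ^^ j) y) < \<delta>" "dist ((T ^^ j) c) ((T ^^ j) z) < \<delta>"
          using that \<delta>(1) by (auto simp: bowen_ball_def bowen_dist_less_iff)
        then show ?thesis using dist_triangle3[of "(T ^^ j) y" "(T ^^ j) z" "(T ^^ j) c"] by linarith
      qed
      have weight: "?q * birkhoff_sum T f k y \<le> ?q * birkhoff_sum T f k c + real k * (\<eta> * ?q)"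
        if "y \<in> ?b" for y
      proof -
        have "birkhoff_sum T f k y \<le> birkhoff_sum T f k c + real k * \<eta>"
          using that \<delta>(1)
          by (intro birkhoff_sum_close[where \<delta> = \<delta>] osc)
            (auto simp: bowen_ball_def bowen_dist_less_iff dist_commute less_imp_le)
        then have "?q * birkhoff_sum T f k y \<le> ?q * (birkhoff_sum T f k c + real k * \<eta>)"
          using q by (intro mult_left_mono) auto
        then show ?thesis by (simp add: algebra_simps)
      qed
      show ?thesis
      proof (cases "n \<le> k")
        case True
        \<comment> \<open>The ball is at least as long as required, so it is a piece by itself. The
          overshoot \<open>k - n\<close> is at most \<open>M\<close>; the terms of \<open>B\<close>
          pay for its Birkhoff sum and for its share of \<open>t\<close>.\<close>
        have "exp (?q * birkhoff_sum T f n y) \<le> exp (B + real n * t) * orbit_weight T f s \<delta> p"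
          if y: "y \<in> ?b" for y
        proof -
          have "- birkhoff_sum T f (k - n) ((T ^^ n) y) \<le> real (k - n) * K"
            using abs_birkhoff_sum_le[of f K T "k - n" "(T ^^ n) y", OF K] by linarith
          also have "\<dots> \<le> real M * K"
            using k K0 by (intro mult_right_mono) auto
          finally have "birkhoff_sum T f n y \<le> birkhoff_sum T f k y + real M * K"
            using birkhoff_sum_add[of T f n "k - n" y] True by simp
          then have "?q * birkhoff_sum T f n y \<le> ?q * (birkhoff_sum T f k y + real M * K)"
            using q by (intro mult_left_mono) auto
          then have 1: "?q * birkhoff_sum T f n y
              \<le> ?q * birkhoff_sum T f k c + real k * (\<eta> * ?q) + real M * (K * ?q)"
            using weight[OF y] by (simp add: algebra_simps)
          have "real (k - n) * t \<le> real (k - n) * (\<bar>s\<bar> + \<eta> * ?q)"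
            unfolding t_def by (intro mult_left_mono) auto
          also have "\<dots> \<le> real M * (\<bar>s\<bar> + \<eta> * ?q)"
            using k q \<open>0 \<le> \<eta>\<close> by (intro mult_right_mono) auto
          finally have 2: "real k * t - real n * t \<le> real M * (\<bar>s\<bar> + \<eta> * ?q)"
            using True by (simp add: of_nat_diff left_diff_distrib)
          have "?q * birkhoff_sum T f n y
              \<le> B + real n * t + (- real k * s + ?q * birkhoff_sum T f k c)"
            using 1 2 unfolding B_def t_def by (simp add: algebra_simps)
          then show ?thesis
            unfolding orbit_weight_def pkc by (simp flip: exp_add)
        qed
        then show ?thesis
          using near True \<delta>(1)
          by (intro exI[of _ "[(?b, orbit_weight T f s \<delta> p)]"])
            (auto simp: bowen_piece_def bowen_dist_less_iff pkc)
      next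
        case False
        then have "n - k < n" "k + (n - k) = n" using k(1) by auto
        obtain ys where ys: "bowen_cball T (n - k + m) ((T ^^ k) x) \<epsilon> \<subseteq> \<Union> (fst ` set ys)"
            "\<And>Aw. Aw \<in> set ys \<Longrightarrow> bowen_piece T f \<delta> B t (n - k) Aw" "sum_list (map snd ys) \<le> 1"
          using less[OF \<open>n - k < n\<close>, of "(T ^^ k) x"] by blast
        \<comment> \<open>Pieces of the remaining orbit are pulled back along \<open>T ^^ k\<close>
          and cut with the first ball.\<close>
        let ?zs = "map (\<lambda>Aw. (?b \<inter> (T ^^ k) -` fst Aw, orbit_weight T f s \<delta> p * snd Aw)) ys"
        \<comment> \<open>Of the \<open>n + m\<close> controlled times, \<open>k\<close> are used up
          and \<open>n - k + m\<close> remain.\<close>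
        have "(T ^^ k) y \<in> bowen_cball T (n - k + m) ((T ^^ k) x) \<epsilon>"
          if "y \<in> bowen_cball T (n + m) x \<epsilon>" for y
          using that \<open>0 \<le> \<epsilon>\<close> False
          by (auto simp: bowen_cball_def bowen_dist_le_iff simp flip: funpow_add_apply)
        then have cov: "bowen_cball T (n + m) x \<epsilon> \<inter> ?b \<subseteq> \<Union> (fst ` set ?zs)"
          using ys(1) by force
        have piece: "bowen_piece T f \<delta> B t n Bw" if Bw: "Bw \<in> set ?zs" for Bw
        proof -
          obtain Aw where Aw: "Aw \<in> set ys"
              "Bw = (?b \<inter> (T ^^ k) -` fst Aw, orbit_weight T f s \<delta> p * snd Aw)"
            using Bw by auto
          have pA: "0 \<le> snd Aw"
              "\<And>y z. y \<in> fst Aw \<Longrightarrow> z \<in> fst Aw \<Longrightarrow> bowen_dist T (n - k) y z < 2 * \<delta>"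
              "\<And>y. y \<in> fst Aw \<Longrightarrow> exp (?q * birkhoff_sum T f (n - k) y)
                \<le> exp (B + real (n - k) * t) * snd Aw"
            using ys(2)[OF Aw(1)] by (auto simp: bowen_piece_def)
          have "bowen_dist T n y z < 2 * \<delta>"
            if y: "y \<in> ?b" "(T ^^ k) y \<in> fst Aw" and z: "z \<in> ?b" "(T ^^ k) z \<in> fst Aw" for y z
          proof -
            have "dist ((T ^^ j) y) ((T ^^ j) z) < 2 * \<delta>" if "j < n" for j
            proof (cases "j < k")
              case True
              then show ?thesis using near y(1) z(1) by blast
            next
              case False
              then have "j - k < n - k" "j = k + (j - k)" using that by auto
              moreover have "dist ((T ^^ i) ((T ^^ k) y)) ((T ^^ i) ((T ^^ k) z)) < 2 * \<delta>"
                if "i < n - k" for i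
                using pA(2)[OF y(2) z(2)] that \<delta>(1) by (simp add: bowen_dist_less_iff)
              ultimately show ?thesis by (metis funpow_add_apply)
            qed
            then show ?thesis using \<delta>(1) by (simp add: bowen_dist_less_iff)
          qed
          moreover have "exp (?q * birkhoff_sum T f n y)
              \<le> exp (B + real n * t) * (orbit_weight T f s \<delta> p * snd Aw)"
            if y: "y \<in> ?b" "(T ^^ k) y \<in> fst Aw" for y
          proof -
            have "exp (?q * birkhoff_sum T f n y)
                = exp (?q * birkhoff_sum T f k y) * exp (?q * birkhoff_sum T f (n - k) ((T ^^ k) y))"
              using birkhoff_sum_add[of T f k "n - k" y] \<open>k + (n - k) = n\<close>
              by (simp add: distrib_left flip: exp_add)
            also have "\<dots> \<le> exp (?q * birkhoff_sum T f k c + real k * (\<eta> * ?q)) *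
                (exp (B + real (n - k) * t) * snd Aw)"
              using weight[OF y(1)] pA(3)[OF y(2)] by (intro mult_mono) auto
            \<comment> \<open>The oscillation error over this block is exactly
              \<open>k * (t - s)\<close>. The overhead \<open>B\<close> comes from the induction
              hypothesis and is not paid again.\<close>
            also have "exp (?q * birkhoff_sum T f k c + real k * (\<eta> * ?q))
                = orbit_weight T f s \<delta> p * exp (real k * t)"
              by (simp add: orbit_weight_def pkc t_def algebra_simps flip: exp_add)
            also have "\<dots> * (exp (B + real (n - k) * t) * snd Aw)
                = exp (real k * t + (B + real (n - k) * t)) * (orbit_weight T f s \<delta> p * snd Aw)"
              by (simp add: exp_add)
            also have "real k * t + (B + real (n - k) * t) = B + real n * t"
              using False by (simp add: of_nat_diff algebra_simps)
            finally show ?thesis .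
          qed
          ultimately show ?thesis
            using pA(1) unfolding bowen_piece_def Aw(2) by simp
        qed
        have "sum_list (map snd ?zs) = orbit_weight T f s \<delta> p * sum_list (map snd ys)"
          by (simp add: o_def sum_list_const_mult)
        also have "\<dots> \<le> orbit_weight T f s \<delta> p * 1"
          using ys(3) by (intro mult_left_mono) auto
        finally show ?thesis using cov piece by (intro exI[of _ ?zs]) (simp add: pkc)
      qed
    qed
    then obtain g where g: "\<And>p. p \<in> P \<Longrightarrow>
          bowen_cball T (n + m) x \<epsilon> \<inter> bowen_ball T (fst p) (snd p) \<delta> \<subseteq> \<Union> (fst ` set (g p))"
        "\<And>p Aw. p \<in> P \<Longrightarrow> Aw \<in> set (g p) \<Longrightarrow> bowen_piece T f \<delta> B t n Aw"
        "\<And>p. p \<in> P \<Longrightarrow> sum_list (map snd (g p)) \<le> orbit_weight T f s \<delta> p"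
      by metis
    \<comment> \<open>Lists keep repeated pieces apart, so weights simply add under
      concatenation.\<close>
    obtain ps where ps: "set ps = P" "distinct ps"
      using finite_distinct_list[OF P(1)] by blast
    show ?thesis
    proof (intro exI[of _ "concat (map g ps)"] conjI)
      \<comment> \<open>The local cover reaches only the ball of length \<open>m\<close>; this is
        why \<open>m\<close> extra times are carried along.\<close>
      have "bowen_cball T (n + m) x \<epsilon> \<subseteq> bowen_cball T m x \<epsilon>"
        using \<open>0 \<le> \<epsilon>\<close> by (intro bowen_cball_antimono) auto
      show "bowen_cball T (n + m) x \<epsilon> \<subseteq> \<Union> (fst ` set (concat (map g ps)))"
      proof
        fix y assume y: "y \<in> bowen_cball T (n + m) x \<epsilon>"
        then obtain p where p: "p \<in> P" "y \<in> bowen_ball T (fst p) (snd p) \<delta>"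
          using P(4) \<open>bowen_cball T (n + m) x \<epsilon> \<subseteq> bowen_cball T m x \<epsilon>\<close> by blast
        then have "y \<in> \<Union> (fst ` set (g p))" using g(1) y by blast
        then show "y \<in> \<Union> (fst ` set (concat (map g ps)))" using p(1) ps(1) by auto
      qed
      show "\<forall>Aw\<in>set (concat (map g ps)). bowen_piece T f \<delta> B t n Aw"
        using g(2) ps(1) by auto
      have "sum_list (map snd (concat (map g ps))) \<le> (\<Sum>p\<leftarrow>ps. orbit_weight T f s \<delta> p)"
        unfolding sum_list_concat_map using g(3) ps(1) by (intro sum_list_mono) auto
      also have "\<dots> \<le> 1"
        using P(5) ps by (simp add: sum_list_distinct_conv_sum_set)
      finally show "sum_list (map snd (concat (map g ps))) \<le> 1" .
    qed
  qed
qed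

section \<open>From closed Bowen balls to the whole space\<close>

text \<open>Orbits are coded by their itineraries through the finite net \<open>C\<close>. Points
  with equal itineraries stay within \<open>\<epsilon>\<close> for \<open>n\<close> steps, so one
  representative per itinerary suffices.\<close>

lemma bowen_cball_cover_card:
  fixes T :: "'a::metric_space \<Rightarrow> 'a" and C :: "'a set"
  assumes "finite C" "\<And>x. \<exists>c\<in>C. dist c x < \<epsilon> / 2"
  obtains X where "finite X" "card X \<le> card C ^ n" "\<And>y. \<exists>c\<in>X. y \<in> bowen_cball T n c \<epsilon>"
proof -
  obtain g where g: "\<And>x. g x \<in> C" "\<And>x. dist (g x) x < \<epsilon> / 2"
    using assms(2) by metis
  have "0 < \<epsilon> / 2" using g(2)[of undefined] zero_le_dist[of "g undefined" undefined] by linarith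
  define h where "h y = restrict (\<lambda>j. g ((T ^^ j) y)) {..<n}" for y
  have sub: "range h \<subseteq> {..<n} \<rightarrow>\<^sub>E C" using g(1) unfolding h_def image_subset_iff restrict_PiE_iff by simp
  have fin: "finite ({..<n} \<rightarrow>\<^sub>E C)" using assms(1) by (intro finite_PiE) auto
  have "finite (range h)" using sub fin by (rule finite_subset)
  show ?thesis
  proof (rule that)
    show "finite (inv h ` range h)" using \<open>finite (range h)\<close> by simp
    have "card (inv h ` range h) \<le> card (range h)"
      using \<open>finite (range h)\<close> by (rule card_image_le)
    also have "\<dots> \<le> card ({..<n} \<rightarrow>\<^sub>E C)" using fin sub by (rule card_mono)
    also have "\<dots> = card C ^ n" by (simp add: card_PiE)
    finally show "card (inv h ` range h) \<le> card C ^ n" .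
  next
    fix y
    let ?c = "inv h (h y)"
    have "h ?c = h y" by (simp add: f_inv_into_f)
    have "dist ((T ^^ j) ?c) ((T ^^ j) y) \<le> \<epsilon>" if "j < n" for j
    proof -
      have "g ((T ^^ j) ?c) = g ((T ^^ j) y)"
        using fun_cong[OF \<open>h ?c = h y\<close>, of j] that by (simp add: h_def)
      then show ?thesis
        using g(2)[of "(T ^^ j) ?c"] g(2)[of "(T ^^ j) y"]
          dist_triangle3[of "(T ^^ j) ?c" "(T ^^ j) y" "g ((T ^^ j) y)"] by (simp add: dist_commute)
    qed
    then have "y \<in> bowen_cball T n ?c \<epsilon>"
      using \<open>0 < \<epsilon> / 2\<close> by (simp add: bowen_cball_def bowen_dist_le_iff)
    then show "\<exists>c\<in>inv h ` range h. y \<in> bowen_cball T n c \<epsilon>" by blast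
  qed
qed

lemma sum_list_filter_le:
  fixes h :: "'b \<Rightarrow> real"
  assumes "\<And>x. x \<in> set xs \<Longrightarrow> 0 \<le> h x"
  shows "sum_list (map h (filter Q xs)) \<le> sum_list (map h xs)"
  using assms by (induction xs) (auto simp: add_increasing)

text \<open>At most \<open>card C ^ (n + m)\<close> closed balls cover the space, each cut into
  pieces of total weight at most 1; one point per piece gives a spanning set. The number of balls
  adds \<open>ln (card C)\<close> to the rate, and doubling the scale adds
  \<open>K * ln 2\<close>.\<close>

lemma span_pressure_le_bowen_pressure:
  fixes T :: "'a::metric_space \<Rightarrow> 'a" and C :: "'a set"
  assumes cpt: "compact (UNIV :: 'a set)" and T: "continuous_on UNIV T"
    and \<delta>: "0 < \<delta>" "\<delta> < 1" and "0 \<le> \<eta>"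
    and osc: "\<And>x y. dist x y \<le> \<delta> \<Longrightarrow> \<bar>f x - f y\<bar> \<le> \<eta>"
    and K: "\<And>x. \<bar>f x\<bar> \<le> K"
    and C: "finite C" "\<And>x. \<exists>c\<in>C. dist c x < \<epsilon> / 2"
    and less: "\<And>x. bowen_pressure T f (stable_set T \<epsilon> UNIV x) \<delta> < ereal s"
  shows "span_pressure T f UNIV (2 * \<delta>) \<le> ereal (s + \<eta> * ln (1 / \<delta>) + (K * ln 2 + ln (card C)))"
proof -
  let ?q = "ln (1 / \<delta>)"
  have "C \<noteq> {}" using C(2) by blast
  then have R: "0 < real (card C)" using C(1) by (simp add: card_gt_0_iff)
  obtain c :: 'a where "dist c undefined < \<epsilon> / 2" using C(2) by blast
  then have "0 \<le> \<epsilon>" using zero_le_dist[of c undefined] by linarith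
  obtain m M where cover: "\<And>y. \<exists>P. finite P \<and> (\<forall>p\<in>P. 1 \<le> fst p \<and> fst p \<le> M) \<and>
      bowen_cball T m y \<epsilon> \<subseteq> (\<Union>p\<in>P. bowen_ball T (fst p) (snd p) \<delta>) \<and>
      (\<Sum>p\<in>P. orbit_weight T f s \<delta> p) \<le> 1"
    using uniform_finite_cover[OF cpt T \<open>0 \<le> \<epsilon>\<close> \<delta>(1) less] by blast
  define t where "t = s + \<eta> * ?q"
  define B where "B = real M * (\<bar>s\<bar> + \<eta> * ?q + K * ?q)"
  have pieces: "\<exists>xs. bowen_cball T (n + m) x \<epsilon> \<subseteq> \<Union> (fst ` set xs) \<and>
      (\<forall>Aw\<in>set xs. bowen_piece T f \<delta> B t n Aw) \<and> sum_list (map snd xs) \<le> 1" for n x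
    unfolding B_def t_def by (rule bowen_cball_pieces[OF \<delta> \<open>0 \<le> \<epsilon>\<close> \<open>0 \<le> \<eta>\<close> osc K cover])
  have "span_sum T f UNIV (2 * \<delta>) n
      \<le> ennreal (exp (B + real m * ln (card C) + real n * (t + (K * ln 2 + ln (card C)))))" for n
  proof -
    obtain X where X: "finite X" "card X \<le> card C ^ (n + m)"
        "\<And>y. \<exists>c\<in>X. y \<in> bowen_cball T (n + m) c \<epsilon>"
      using bowen_cball_cover_card[OF C, where n = "n + m" and T = T] by blast
    obtain xs where xs: "set xs = X" "distinct xs"
      using finite_distinct_list[OF X(1)] by blast
    obtain g where g: "\<And>x. bowen_cball T (n + m) x \<epsilon> \<subseteq> \<Union> (fst ` set (g x))"
        "\<And>x Aw. Aw \<in> set (g x) \<Longrightarrow> bowen_piece T f \<delta> B t n Aw"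
        "\<And>x. sum_list (map snd (g x)) \<le> 1"
      using pieces[of n] by metis
    define L where "L = concat (map g xs)"
    \<comment> \<open>Empty pieces offer no representative; dropping them cannot raise the
      nonnegative total weight.\<close>
    define L' where "L' = filter (\<lambda>Aw. fst Aw \<noteq> {}) L"
    have L: "bowen_piece T f \<delta> B t n Aw" if "Aw \<in> set L" for Aw
      using that g(2) unfolding L_def set_concat set_map by blast
    have "sum_list (map snd L') \<le> sum_list (map snd L)"
      unfolding L'_def using L by (intro sum_list_filter_le) (auto simp: bowen_piece_def)
    also have "\<dots> \<le> (\<Sum>x\<leftarrow>xs. 1)"
      unfolding L_def sum_list_concat_map using g(3) by (intro sum_list_mono) auto
    also have "\<dots> = real (card X)"
      using distinct_card[OF xs(2)] xs(1) by (simp add: sum_list_triv)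
    also have "\<dots> \<le> real (card C) ^ (n + m)"
      using X(2) by (metis of_nat_le_iff of_nat_power)
    finally have total: "sum_list (map snd L') \<le> real (card C) ^ (n + m)" .
    define pick :: "'a set \<times> real \<Rightarrow> 'a" where "pick Aw = (SOME y. y \<in> fst Aw)" for Aw
    have pick: "pick Aw \<in> fst Aw" if "Aw \<in> set L'" for Aw
      using that by (auto simp: L'_def pick_def some_in_eq)
    let ?E = "set (map pick L')" and ?h = "\<lambda>y. (1 / (2 * \<delta>)) powr birkhoff_sum T f n y"
    have "spanning_set T n (2 * \<delta>) UNIV ?E"
      unfolding spanning_set_def
    proof
      fix y
      obtain c where c: "c \<in> X" "y \<in> bowen_cball T (n + m) c \<epsilon>" using X(3) by blast
      then obtain Aw where Aw: "Aw \<in> set (g c)" "y \<in> fst Aw" using g(1)[of c] by auto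
      then have "Aw \<in> set L'" using c(1) xs(1) by (auto simp: L'_def L_def)
      moreover have "bowen_dist T n y (pick Aw) < 2 * \<delta>"
        using g(2)[OF Aw(1)] Aw(2) pick[OF \<open>Aw \<in> set L'\<close>] by (auto simp: bowen_piece_def)
      ultimately show "\<exists>z\<in>?E. bowen_dist T n y z < 2 * \<delta>" by auto
    qed
    then have "span_sum T f UNIV (2 * \<delta>) n \<le> (\<Sum>\<^sub>\<infinity>y\<in>?E. ennreal (?h y))"
      unfolding span_sum_def by (intro INF_lower) simp
    also have "\<dots> = ennreal (sum ?h ?E)" by simp
    \<comment> \<open>Different pieces may share a representative.\<close>
    also have "sum ?h ?E \<le> sum_list (map ?h (map pick L'))"
      by (rule sum_set_le_sum_list) simp
    also have "\<dots> = (\<Sum>Aw\<leftarrow>L'. ?h (pick Aw))" by (simp add: o_def)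
    also have "\<dots> \<le> (\<Sum>Aw\<leftarrow>L'. exp (B + real n * (t + K * ln 2)) * snd Aw)"
    proof (rule sum_list_mono)
      fix Aw assume Aw: "Aw \<in> set L'"
      let ?b = "birkhoff_sum T f n (pick Aw)"
      have "- ?b * ln 2 \<le> (real n * K) * ln 2"
        using abs_birkhoff_sum_le[of f K T n "pick Aw", OF K] by (intro mult_right_mono) auto
      moreover have ln2: "ln (1 / (2 * \<delta>)) = ?q - ln 2"
        using \<delta>(1) by (simp add: ln_div ln_mult)
      ultimately have "?b * ln (1 / (2 * \<delta>)) \<le> real n * K * ln 2 + ?q * ?b"
        unfolding ln2 by (simp add: algebra_simps)
      then have "?h (pick Aw) \<le> exp (real n * K * ln 2 + ?q * ?b)"
        using \<delta>(1) unfolding powr_def by simp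
      also have "\<dots> = exp (real n * K * ln 2) * exp (?q * ?b)" by (rule exp_add)
      also have "\<dots> \<le> exp (real n * K * ln 2) * (exp (B + real n * t) * snd Aw)"
        using L[of Aw] Aw pick[OF Aw] by (intro mult_left_mono) (auto simp: L'_def bowen_piece_def)
      also have "\<dots> = exp (B + real n * (t + K * ln 2)) * snd Aw"
        by (simp add: algebra_simps exp_add)
      finally show "?h (pick Aw) \<le> exp (B + real n * (t + K * ln 2)) * snd Aw" .
    qed
    also have "\<dots> = exp (B + real n * (t + K * ln 2)) * sum_list (map snd L')"
      by (simp add: sum_list_const_mult)
    also have "\<dots> \<le> exp (B + real n * (t + K * ln 2)) * real (card C) ^ (n + m)"
      using total by (intro mult_left_mono) auto
    also have "real (card C) ^ (n + m) = exp (real (n + m) * ln (card C))"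
      by (simp only: exp_of_nat_mult exp_ln[OF R])
    \<comment> \<open>The factor from the extra \<open>m\<close> steps is independent of
      \<open>n\<close> and joins the overhead.\<close>
    also have "exp (B + real n * (t + K * ln 2)) * \<dots>
        = exp (B + real m * ln (card C) + real n * (t + (K * ln 2 + ln (card C))))"
      by (simp add: algebra_simps flip: exp_add)
    finally show ?thesis by (simp add: ennreal_leI)
  qed
  then show ?thesis unfolding t_def by (intro span_pressure_le)
qed

section \<open>Monotonicity in the set and the cycle of inequalities\<close>

lemma span_pressure_mono:
  assumes "Z \<subseteq> Z'"
  shows "span_pressure T f Z \<delta> \<le> span_pressure T f Z' \<delta>"
  unfolding span_pressure_def
proof (intro Limsup_mono always_eventually allI ereal_mult_left_mono ext_ln_mono)
  fix n
  show "span_sum T f Z \<delta> n \<le> span_sum T f Z' \<delta> n"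
    unfolding span_sum_def
  proof (rule INF_superset_mono)
    show "{E. spanning_set T n \<delta> Z' E} \<subseteq> {E. spanning_set T n \<delta> Z E}"
      using assms unfolding spanning_set_def by blast
  qed simp
qed simp

lemma bowen_pressure_mono:
  assumes "Z \<subseteq> Z'"
  shows "bowen_pressure T f Z \<delta> \<le> bowen_pressure T f Z' \<delta>"
proof -
  have pre: "bowen_pre T f Z s \<delta> N \<le> bowen_pre T f Z' s \<delta> N" for s N
    unfolding bowen_pre_def using assms by (intro Inf_superset_mono) blast
  have "bowen_measure T f Z s \<delta> \<le> bowen_measure T f Z' s \<delta>" for s
    unfolding bowen_measure_eq_SUP by (intro SUP_mono') (rule pre)
  then have "bowen_measure T f Z s \<delta> = 0" if "bowen_measure T f Z' s \<delta> = 0" for s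
    using that by (metis le_zero_eq)
  then show ?thesis
    unfolding bowen_pressure_def by (intro Inf_superset_mono) blast
qed

theorem theorem1p2:
  fixes T :: "'a::metric_space \<Rightarrow> 'a" and f :: "'a \<Rightarrow> real"
    and S :: "nat set" and \<epsilon> :: real
  assumes "compact (UNIV :: 'a set)"
    and "continuous_on UNIV T"
    and "continuous_on UNIV f"
    and "\<epsilon> > 0"
  shows "upper_mdim T f UNIV =
           Limsup (at_right 0) (\<lambda>\<delta>. ereal (1 / ln (1 / \<delta>)) *
             (SUP x. bowen_pressure T f (stable_set T \<epsilon> S x) \<delta>)) \<and>
         Limsup (at_right 0) (\<lambda>\<delta>. ereal (1 / ln (1 / \<delta>)) *
             (SUP x. bowen_pressure T f (stable_set T \<epsilon> S x) \<delta>)) =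
           Limsup (at_right 0) (\<lambda>\<delta>. ereal (1 / ln (1 / \<delta>)) *
             (SUP x. packing_pressure T f (stable_set T \<epsilon> S x) \<delta>)) \<and>
         Limsup (at_right 0) (\<lambda>\<delta>. ereal (1 / ln (1 / \<delta>)) *
             (SUP x. packing_pressure T f (stable_set T \<epsilon> S x) \<delta>)) =
           Limsup (at_right 0) (\<lambda>\<delta>. ereal (1 / ln (1 / \<delta>)) *
             (SUP x. span_pressure T f (stable_set T \<epsilon> S x) \<delta>))"
proof -
  let ?lim = "\<lambda>a. Limsup (at_right 0) (\<lambda>\<delta>. ereal (1 / ln (1 / \<delta>)) * a \<delta>)"
  let ?W = "stable_set T \<epsilon> S"
  let ?bowen = "\<lambda>\<delta>. SUP x. bowen_pressure T f (?W x) \<delta>"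
  let ?packing = "\<lambda>\<delta>. SUP x. packing_pressure T f (?W x) \<delta>"
  let ?span = "\<lambda>\<delta>. SUP x. span_pressure T f (?W x) \<delta>"
  have "bounded (range f)"
    using assms(1,3) by (intro compact_imp_bounded compact_continuous_image)
  then obtain K where K: "\<And>x. \<bar>f x\<bar> \<le> K"
    by (auto simp: bounded_iff)
  have small: "\<forall>\<^sub>F \<delta> in at_right 0. 0 < \<delta> \<and> \<delta> < 1 \<and> (\<forall>x y. dist x y \<le> \<delta> \<longrightarrow> \<bar>f x - f y\<bar> \<le> \<eta>)"
    if "0 < \<eta>" for \<eta>
  proof -
    have "\<exists>d>0. \<forall>x\<in>UNIV. \<forall>y\<in>UNIV. dist y x < d \<longrightarrow> dist (f y) (f x) < \<eta>"
      using compact_uniformly_continuous[OF assms(3,1)] that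
      unfolding uniformly_continuous_on_def by blast
    then obtain d where d: "0 < d" "\<And>x y. dist x y < d \<Longrightarrow> dist (f x) (f y) < \<eta>"
      by auto
    have "\<forall>\<^sub>F \<delta> in at_right 0. 0 < \<delta> \<and> \<delta> < min 1 d"
      using d(1) by (auto simp: eventually_at_right_field intro!: exI[of _ "min 1 d"])
    then show ?thesis
      by eventually_elim (use d(2) in \<open>force simp: dist_real_def intro: less_imp_le\<close>)
  qed
  have "0 < \<epsilon> / 2" using assms(4) by simp
  \<comment> \<open>The net depends on \<open>\<epsilon>\<close> alone and is fixed before
    \<open>\<delta>\<close>, so \<open>ln (card C)\<close> is a constant in the limit.\<close>
  then obtain C where C: "finite C" "\<And>x. \<exists>c\<in>C. bowen_dist T 1 c x < \<epsilon> / 2"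
    using compact_finite_bowen_cover[OF assms(1,2)] by metis
  have "bowen_dist T 1 c x = dist c x" for c x
    by (simp add: bowen_dist_def lessThan_Suc)
  note C = C[unfolded this]
  have mdim: "upper_mdim T f UNIV = ?lim (span_pressure T f UNIV)"
    unfolding upper_mdim_def
  proof (rule Limsup_eq)
    show "\<forall>\<^sub>F \<delta> in at_right 0. span_pressure T f UNIV \<delta> / ereal (ln (1 / \<delta>))
        = ereal (1 / ln (1 / \<delta>)) * span_pressure T f UNIV \<delta>"
      using small[OF zero_less_one]
      by eventually_elim (simp add: divide_ereal_def mult.commute inverse_eq_divide)
  qed
  have 1: "?lim (span_pressure T f UNIV) \<le> ?lim ?bowen"
  proof (rule Limsup_log_scale_le[where k = 2 and C = "K * ln 2 + ln (card C)"])
    fix \<eta> :: real assume "0 < \<eta>"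
    from small[OF this]
    show "\<forall>\<^sub>F \<delta> in at_right 0. \<forall>s. ?bowen \<delta> < ereal s \<longrightarrow> span_pressure T f UNIV (2 * \<delta>)
        \<le> ereal (s + \<eta> * ln (1 / \<delta>) + (K * ln 2 + ln (card C)))"
    proof (eventually_elim, intro allI impI)
      fix \<delta> s assume \<delta>: "0 < \<delta> \<and> \<delta> < 1 \<and> (\<forall>x y. dist x y \<le> \<delta> \<longrightarrow> \<bar>f x - f y\<bar> \<le> \<eta>)"
        and s: "?bowen \<delta> < ereal s"
      have "bowen_pressure T f (stable_set T \<epsilon> UNIV x) \<delta> < ereal s" for x
      proof -
        \<comment> \<open>Controlling more times shrinks the stable set, which reduces any
          \<open>S\<close> to all of \<open>UNIV\<close>.\<close>
        have "bowen_pressure T f (stable_set T \<epsilon> UNIV x) \<delta> \<le> bowen_pressure T f (?W x) \<delta>"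
          by (intro bowen_pressure_mono) (auto simp: stable_set_def)
        also have "\<dots> \<le> ?bowen \<delta>" by (rule SUP_upper) simp
        finally show ?thesis using s by (rule le_less_trans)
      qed
      then show "span_pressure T f UNIV (2 * \<delta>)
          \<le> ereal (s + \<eta> * ln (1 / \<delta>) + (K * ln 2 + ln (card C)))"
        using \<delta> \<open>0 < \<eta>\<close> by (intro span_pressure_le_bowen_pressure[OF assms(1,2) _ _ _ _ K C]) auto
    qed
  qed simp
  have 2: "?lim ?bowen \<le> ?lim ?packing"
  proof (rule Limsup_log_scale_le[where k = 3 and C = "K * ln 3"])
    fix \<eta> :: real assume "0 < \<eta>"
    from small[OF this]
    show "\<forall>\<^sub>F \<delta> in at_right 0. \<forall>s. ?packing \<delta> < ereal s \<longrightarrow>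
        ?bowen (3 * \<delta>) \<le> ereal (s + \<eta> * ln (1 / \<delta>) + K * ln 3)"
    proof (eventually_elim, intro allI impI SUP_least)
      fix \<delta> s x assume \<delta>: "0 < \<delta> \<and> \<delta> < 1 \<and> (\<forall>x y. dist x y \<le> \<delta> \<longrightarrow> \<bar>f x - f y\<bar> \<le> \<eta>)"
        and s: "?packing \<delta> < ereal s"
      have "packing_pressure T f (?W x) \<delta> < ereal s"
        by (rule le_less_trans[OF SUP_upper s]) simp
      then have "bowen_pressure T f (?W x) (3 * \<delta>) \<le> ereal (s + K * ln 3)"
        using \<delta> by (intro bowen_pressure_le_packing_pressure[OF assms(1,2) _ K]) auto
      also have "\<dots> \<le> ereal (s + \<eta> * ln (1 / \<delta>) + K * ln 3)"
        using \<delta> \<open>0 < \<eta>\<close> by simp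
      finally show "bowen_pressure T f (?W x) (3 * \<delta>) \<le> ereal (s + \<eta> * ln (1 / \<delta>) + K * ln 3)" .
    qed
  qed simp
  have 3: "?lim ?packing \<le> ?lim ?span"
  proof (rule Limsup_log_scale_le[where k = 1 and C = 0])
    fix \<eta> :: real assume "0 < \<eta>"
    from small[OF this]
    show "\<forall>\<^sub>F \<delta> in at_right 0. \<forall>s. ?span \<delta> < ereal s \<longrightarrow>
        ?packing (1 * \<delta>) \<le> ereal (s + \<eta> * ln (1 / \<delta>) + 0)"
    proof (eventually_elim, intro allI impI SUP_least)
      fix \<delta> s x assume \<delta>: "0 < \<delta> \<and> \<delta> < 1 \<and> (\<forall>x y. dist x y \<le> \<delta> \<longrightarrow> \<bar>f x - f y\<bar> \<le> \<eta>)"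
        and s: "?span \<delta> < ereal s"
      have "span_pressure T f (?W x) \<delta> < ereal s"
        by (rule le_less_trans[OF SUP_upper s]) simp
      then show "packing_pressure T f (?W x) (1 * \<delta>) \<le> ereal (s + \<eta> * ln (1 / \<delta>) + 0)"
        using \<delta> packing_pressure_le_span_pressure[of \<delta> f \<eta> T "?W x" s] by simp
    qed
  qed simp
  \<comment> \<open>This closes the cycle, so all four limits coincide.\<close>
  have 4: "?lim ?span \<le> ?lim (span_pressure T f UNIV)"
  proof (rule Limsup_mono)
    show "\<forall>\<^sub>F \<delta> in at_right 0. ereal (1 / ln (1 / \<delta>)) * ?span \<delta>
        \<le> ereal (1 / ln (1 / \<delta>)) * span_pressure T f UNIV \<delta>"
      using small[OF zero_less_one]
      by eventually_elim (auto intro!: ereal_mult_left_mono SUP_least span_pressure_mono)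
  qed
  show ?thesis using mdim 1 2 3 4 by auto
qed

end
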